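(* Suppose $0<p<\infty$, $K\ge 1$, and $f=u+iv$ is a harmonic $K$-quasiregular mapping in the unit disk $\mathbb{D}$ (with $u,v$ real-valued). If $u$ is in the harmonic Bergman space $a^p$, then $v$ is also in $a^p$, and $$\|v\|_p \le C_{p,K}\,\|u\|_p,$$ where $C_{p,K}$ is a constant that depends only on $p$ and $K$.
   Context: $\mathbb{D}$ is the open unit disk in $\mathbb{C}$ and $dA(z)=\frac{1}{\pi}\,dx\,dy$ is the normalized area measure on $\mathbb{D}$. A complex-valued function $f=u+iv$ on $\mathbb{D}$ is harmonic if $u$ and $v$ are real-valued harmonic functions in $\mathbb{D}$; it has a unique representation $f=h+\overline{g}$ with $h,g$ analytic in $\mathbb{D}$ and $g(0)=0$. For $0<p<\infty$, a (real- or complex-valued) harmonic function $f$ in $\mathbb{D}$ belongs to the harmonic Bergman space $a^p$ if $\|f\|_p:=\left(\int_{\mathbb{D}}|f(z)|^p\,dA(z)\right)^{1/p}<\infty$. For $K\ge 1$, a sense-preserving harmonic function $f=h+\overline{g}$ in $\mathbb{D}$ is called $K$-quasiregular if its dilatation satisfies $D_f:=\frac{|f_z|+|f_{\bar z}|}{|f_z|-|f_{\bar z}|}\le K$ throughout $\mathbb{D}$; equivalently, its analytic dilatation $\omega:=g'/h'$ satisfies $|\omega(z)|\le k<1$ for all $z\in\mathbb{D}$, where $k:=\frac{K-1}{K+1}$.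
   Formalization: The norm inequality is stated under the normalization v(0)=0, since without it f(z)=z+iM with M large is a counterexample; that v is in a^p is asserted for every f. *)

theory Defs
  imports "HOL-Complex_Analysis.Complex_Analysis"
begin

abbreviation unit_disk :: "complex set" where
  "unit_disk \<equiv> ball 0 1"

text \<open>Partial derivatives with respect to the real coordinates of \<open>z = x + iy\<close>.\<close>

definition partial_x :: "(complex \<Rightarrow> 'a::real_normed_vector) \<Rightarrow> complex \<Rightarrow> 'a" where
  "partial_x f z = frechet_derivative f (at z) 1"

definition partial_y :: "(complex \<Rightarrow> 'a::real_normed_vector) \<Rightarrow> complex \<Rightarrow> 'a" where
  "partial_y f z = frechet_derivative f (at z) \<i>"

definition C1_on :: "complex set \<Rightarrow> (complex \<Rightarrow> 'a::real_normed_vector) \<Rightarrow> bool" where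
  "C1_on S f \<longleftrightarrow> (\<forall>z\<in>S. f differentiable (at z)) \<and>
     continuous_on S (partial_x f) \<and> continuous_on S (partial_y f)"

definition C2_on :: "complex set \<Rightarrow> (complex \<Rightarrow> 'a::real_normed_vector) \<Rightarrow> bool" where
  "C2_on S f \<longleftrightarrow> C1_on S f \<and> C1_on S (partial_x f) \<and> C1_on S (partial_y f)"

text \<open>Intended for open \<open>S\<close>, because the derivatives are two-sided. For complex-valued \<open>f\<close> this
  amounts to harmonicity of the real and imaginary parts.\<close>

definition harmonic_on :: "complex set \<Rightarrow> (complex \<Rightarrow> 'a::real_normed_vector) \<Rightarrow> bool" where
  "harmonic_on S f \<longleftrightarrow> C2_on S f \<and>
     (\<forall>z\<in>S. partial_x (partial_x f) z + partial_y (partial_y f) z = 0)"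

definition disk_area :: "complex measure" where
  "disk_area = scale_measure (ennreal (1 / pi)) (restrict_space lborel unit_disk)"

definition bergman_norm :: "real \<Rightarrow> (complex \<Rightarrow> 'a::real_normed_vector) \<Rightarrow> real" where
  "bergman_norm p f = (LINT z|disk_area. norm (f z) powr p) powr (1 / p)"

text \<open>Integrability is required explicitly: the Bochner integral of a non-integrable function is 0,
  so \<^const>\<open>bergman_norm\<close> is meaningful only for members of this space.\<close>

definition harmonic_bergman :: "real \<Rightarrow> (complex \<Rightarrow> 'a::real_normed_vector) set" where
  "harmonic_bergman p =
     {f. harmonic_on unit_disk f \<and> integrable disk_area (\<lambda>z. norm (f z) powr p)}"

definition wirtinger_z :: "(complex \<Rightarrow> complex) \<Rightarrow> complex \<Rightarrow> complex" where
  "wirtinger_z f z = (partial_x f z - \<i> * partial_y f z) / 2"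

definition wirtinger_zbar :: "(complex \<Rightarrow> complex) \<Rightarrow> complex \<Rightarrow> complex" where
  "wirtinger_zbar f z = (partial_x f z + \<i> * partial_y f z) / 2"

text \<open>For \<open>f = h + cnj g\<close> with \<open>h\<close>, \<open>g\<close> analytic, \<open>wirtinger_z f = h'\<close> and
  \<open>cnj (wirtinger_zbar f) = g'\<close>. Sense-preserving means that \<open>h'\<close> is not identically zero and that
  the analytic dilatation \<open>g' / h'\<close>, after removal of its singularities at the zeros of \<open>h'\<close>, is an
  analytic function \<open>\<omega>\<close> of modulus less than 1. Isolated critical points are thus allowed
  (e.g. \<open>f z = z\<^sup>2\<close>), as usual for quasiregular maps.\<close>

definition sense_preserving_harmonic :: "(complex \<Rightarrow> complex) \<Rightarrow> bool" where
  "sense_preserving_harmonic f \<longleftrightarrow>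
     harmonic_on unit_disk (\<lambda>z. Re (f z)) \<and> harmonic_on unit_disk (\<lambda>z. Im (f z)) \<and>
     (\<exists>z\<in>unit_disk. wirtinger_z f z \<noteq> 0) \<and>
     (\<exists>\<omega>. \<omega> holomorphic_on unit_disk \<and>
        (\<forall>z\<in>unit_disk. norm (\<omega> z) < 1 \<and>
           cnj (wirtinger_zbar f z) = \<omega> z * wirtinger_z f z))"

definition dilatation :: "(complex \<Rightarrow> complex) \<Rightarrow> complex \<Rightarrow> real" where
  "dilatation f z =
     (norm (wirtinger_z f z) + norm (wirtinger_zbar f z)) /
     (norm (wirtinger_z f z) - norm (wirtinger_zbar f z))"

text \<open>For sense-preserving \<open>f\<close> the denominator of \<^const>\<open>dilatation\<close> is positive except at the
  isolated zeros of \<open>wirtinger_z f\<close>, where the quotient is \<open>0 / 0 = 0\<close> and the bound holds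
  vacuously; no information is lost there, since by continuity of \<open>\<omega>\<close> the bound
  \<open>norm (\<omega> z) \<le> (K - 1) / (K + 1)\<close> extends to these points.\<close>

definition harmonic_quasiregular :: "real \<Rightarrow> (complex \<Rightarrow> complex) \<Rightarrow> bool" where
  "harmonic_quasiregular K f \<longleftrightarrow>
     sense_preserving_harmonic f \<and> (\<forall>z\<in>unit_disk. dilatation f z \<le> K)"

end

theory Submission
  imports Defs
begin

text \<open>
  The Cauchy-Riemann equations and the dilatation bound give \<open>\<bar>\<nabla>v\<bar> \<le> K * \<bar>\<nabla>u\<bar>\<close>, where \<open>u\<close> is the real part of a
  holomorphic \<open>F\<close> with \<open>\<bar>\<nabla>u\<bar> = \<bar>F'\<bar>\<close>. For every \<open>p > 0\<close>, \<open>(R * \<bar>F'(c)\<bar>) powr p\<close> is at most a constant times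
  the average of \<open>\<bar>u\<bar> powr p\<close> over the disk of radius \<open>R\<close> around \<open>c\<close>. Integrating \<open>\<nabla>v\<close> along the radius from
  \<open>0\<close> to \<open>z\<close> in steps that double the distance to the circle bounds \<open>\<bar>v(z) - v(0)\<bar> powr p\<close> by a sum over \<open>i\<close> of
  \<open>(3/2) ^ i\<close> times an integral of \<open>\<bar>u(w)\<bar> powr p / (1 - \<bar>w\<bar>)\<^sup>2\<close> over those \<open>w\<close> with \<open>1 - \<bar>w\<bar>\<close> comparable to
  \<open>2 ^ i * (1 - \<bar>z\<bar>)\<close> and angularly close to \<open>z\<close>. By Tonelli it remains to see that, for fixed \<open>w\<close>, the set of
  such \<open>z\<close> has area of order \<open>2 ^ (-i) * (1 - \<bar>w\<bar>)\<^sup>2\<close>, so that the sum over \<open>i\<close> is geometric.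
\<close>

subsection \<open>Mean values over disks\<close>

lemma nn_integral_lborel_translate:
  fixes f :: "'a::euclidean_space \<Rightarrow> ennreal"
  assumes [measurable]: "f \<in> borel_measurable borel"
  shows "(\<integral>\<^sup>+x. f (c + x) \<partial>lborel) = (\<integral>\<^sup>+x. f x \<partial>lborel)"
  by (subst (2) lborel_distr_plus[of c, symmetric]) (simp add: nn_integral_distr)

text \<open>Computing the integral of \<open>indicator A (w * x) * indicator B (y - w * x)\<close> over \<open>(x, y)\<close> in both
  orders, with \<open>B\<close> the rotation-invariant unit disk, compares the measures of \<open>A\<close> and of its rotation.\<close>

lemma lborel_distr_rotation:
  fixes w :: complex
  assumes w: "norm w = 1"
  shows "distr lborel borel ((*) w) = lborel"
proof (rule measure_eqI)
  show "sets (distr lborel borel ((*) w)) = sets lborel" by simp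
next
  fix A assume "A \<in> sets (distr lborel borel ((*) w))"
  then have A[measurable]: "A \<in> sets borel" by simp
  define B where "B = ball (0::complex) 1"
  have B[measurable]: "B \<in> sets borel" by (simp add: B_def)
  \<comment> \<open>Finite and nonzero, so the measure of \<open>B\<close> can be cancelled at the
    end.\<close>
  have B0: "emeasure lborel B \<noteq> 0" "emeasure lborel B \<noteq> \<infinity>"
    using emeasure_lborel_ball_finite[of "0::complex" 1] by (auto simp: B_def emeasure_ball unit_ball_vol_2)
  define a b :: "complex \<Rightarrow> ennreal" where "a = indicator A" and "b = indicator B"
  have [measurable]: "a \<in> borel_measurable borel" "b \<in> borel_measurable borel"
    by (simp_all add: a_def b_def)
  have b_sym: "b (x - y) = b (y - x)" for x y
    by (simp add: b_def B_def indicator_def norm_minus_commute)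
  have b_rot: "b (w * x) = b x" for x
    by (simp add: b_def B_def indicator_def norm_mult w)
  have w0: "w \<noteq> 0" using w by auto
  have tr: "(\<integral>\<^sup>+y. b (y - c) \<partial>lborel) = emeasure lborel B" for c
    using nn_integral_lborel_translate[of b "-c"] by (simp add: b_def)
  have "emeasure (distr lborel borel ((*) w)) A * emeasure lborel B
      = (\<integral>\<^sup>+x. a (w * x) \<partial>lborel) * emeasure lborel B"
    using nn_integral_distr[of "(*) w" lborel borel a] by (simp add: a_def)
  also have "\<dots> = (\<integral>\<^sup>+x. a (w * x) * (\<integral>\<^sup>+y. b (y - w * x) \<partial>lborel) \<partial>lborel)"
    by (simp add: tr nn_integral_multc)
  also have "\<dots> = (\<integral>\<^sup>+x. (\<integral>\<^sup>+y. a (w * x) * b (w * x - y) \<partial>lborel) \<partial>lborel)"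
    by (simp add: nn_integral_cmult b_sym)
  also have "\<dots> = (\<integral>\<^sup>+y. (\<integral>\<^sup>+x. a (w * x) * b (w * x - y) \<partial>lborel) \<partial>lborel)"
    by (rule lborel_pair.Fubini'[symmetric]) simp
  also have "\<dots> = (\<integral>\<^sup>+y. (\<integral>\<^sup>+x. a (w * x + y) * b (w * x) \<partial>lborel) \<partial>lborel)"
  proof (rule nn_integral_cong)
    fix y :: complex
    show "(\<integral>\<^sup>+x. a (w * x) * b (w * x - y) \<partial>lborel) = (\<integral>\<^sup>+x. a (w * x + y) * b (w * x) \<partial>lborel)"
      \<comment> \<open>Translating \<open>x\<close> by \<open>y / w\<close> adds \<open>y\<close>
        to \<open>w * x\<close>.\<close>
      by (subst nn_integral_lborel_translate[of _ "y / w", symmetric])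
         (simp_all add: w0 distrib_left add.commute)
  qed
  also have "\<dots> = (\<integral>\<^sup>+x. (\<integral>\<^sup>+y. a (w * x + y) * b (w * x) \<partial>lborel) \<partial>lborel)"
    by (rule lborel_pair.Fubini') simp
  also have "\<dots> = (\<integral>\<^sup>+x. emeasure lborel A * b x \<partial>lborel)"
    by (simp add: nn_integral_multc nn_integral_lborel_translate b_rot) (simp add: a_def)
  also have "\<dots> = emeasure lborel A * emeasure lborel B"
    by (simp add: nn_integral_cmult) (simp add: b_def)
  finally show "emeasure (distr lborel borel ((*) w)) A = emeasure lborel A"
    using B0 by (metis ennreal_mult_cancel_left mult.commute infinity_ennreal_def)
qed

lemma nn_integral_rotation:
  fixes f :: "complex \<Rightarrow> ennreal"
  assumes [measurable]: "f \<in> borel_measurable borel" and "norm w = 1"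
  shows "(\<integral>\<^sup>+z. f (w * z) \<partial>lborel) = (\<integral>\<^sup>+z. f z \<partial>lborel)"
  by (subst (2) lborel_distr_rotation[OF assms(2), symmetric]) (simp add: nn_integral_distr)

text \<open>Cauchy's integral formula on the unit circle, applied to the function sending
  \<open>w\<close> to \<open>F (a + z * w)\<close>. Rescaling by \<open>z\<close> treats all radii
  at once, including \<open>z = 0\<close>, and writes the circle as the orbit of \<open>z\<close>
  under rotations.\<close>

lemma circle_mean:
  fixes F :: "complex \<Rightarrow> complex"
  assumes hol: "F holomorphic_on S" and S: "open S" "cball a (norm z) \<subseteq> S"
  shows "((\<lambda>t. F (a + z * cis t)) has_integral (2 * pi * F a)) {0..2*pi}"
proof -
  define G where "G w = F (a + z * w)" for w
  have "G holomorphic_on cball 0 1"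
  proof -
    have "(\<lambda>w. a + z * w) ` cball 0 1 \<subseteq> S"
      using S(2) by (auto simp: subset_iff dist_norm norm_mult mult_left_le)
    then have "(F \<circ> (\<lambda>w. a + z * w)) holomorphic_on cball 0 1"
      by (intro holomorphic_on_compose_gen[OF _ hol] holomorphic_intros)
    then show ?thesis by (simp add: G_def[abs_def] comp_def)
  qed
  then have "((\<lambda>u. G u / (u - 0)) has_contour_integral (2 * of_real pi * \<i> * G 0)) (circlepath 0 1)"
    by (intro Cauchy_integral_circlepath)
      (auto intro: holomorphic_on_imp_continuous_on holomorphic_on_subset)
  then have "((\<lambda>t. G (cis t) / cis t * \<i> * cis t) has_integral (2 * of_real pi * \<i> * G 0)) {0..2*pi}"
    unfolding circlepath_def by (subst (asm) has_contour_integral_part_circlepath_iff) auto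
  then have "((\<lambda>t. \<i> * G (cis t)) has_integral (2 * of_real pi * \<i> * G 0)) {0..2*pi}"
    by (rule has_integral_eq[rotated]) (auto simp: field_simps)
  from has_integral_mult_right[OF this, of "-\<i>"] show ?thesis
    by (simp add: algebra_simps G_def)
qed

text \<open>Averages \<open>circle_mean\<close> over all \<open>z\<close> in a disk around 0,
  without polar coordinates: once the order of integration over \<open>z\<close> and the angle is
  exchanged, rotation invariance of \<open>lborel\<close> removes the angle.\<close>

lemma sub_mean_value:
  fixes F :: "complex \<Rightarrow> complex"
  assumes hol: "F holomorphic_on S" and S: "open S" "cball a r \<subseteq> S" and r: "0 < r"
  shows "ennreal (pi * r\<^sup>2 * \<bar>Re (F a)\<bar>)
    \<le> (\<integral>\<^sup>+z. indicator (ball a r) z * ennreal \<bar>Re (F z)\<bar> \<partial>lborel)"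
proof -
  define g :: "complex \<Rightarrow> real" where "g z = indicator (ball 0 r) z * \<bar>Re (F (a + z))\<bar>" for z
  have sub: "a + z \<in> S" if "norm z \<le> r" for z
    using that S by (auto simp: subset_iff dist_norm norm_minus_commute)
  have contF: "continuous_on S F" using hol holomorphic_on_imp_continuous_on by blast
  have g[measurable]: "g \<in> borel_measurable borel"
  proof -
    have "continuous_on (ball 0 r) (\<lambda>z. \<bar>Re (F (a + z))\<bar>)"
      by (intro continuous_intros continuous_on_compose2[OF contF])
        (use S(2) ball_subset_cball[of a r] in auto)
    then show ?thesis unfolding g_def
      using borel_measurable_continuous_on_indicator[of "ball 0 r" "\<lambda>z. \<bar>Re (F (a + z))\<bar>"] by simp
  qed
  have circ: "ennreal (2 * pi) * (ennreal \<bar>Re (F a)\<bar> * indicator (ball 0 r) z)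
      \<le> (\<integral>\<^sup>+t. indicator {0..2*pi} t * ennreal (g (cis t * z)) \<partial>lborel)" for z
  proof (cases "norm z < r")
    case True
    let ?f = "\<lambda>t. \<bar>Re (F (a + z * cis t))\<bar>"
    have *: "((\<lambda>t. Re (F (a + z * cis t))) has_integral (2 * pi * Re (F a))) {0..2*pi}"
      using has_integral_Re[OF circle_mean[OF hol S(1), of a z]] True S(2)
        subset_trans[OF subset_cball[of "norm z" r a]] by simp
    have cont: "continuous_on {0..2*pi} (\<lambda>t. F (a + z * cis t))"
      by (intro continuous_intros continuous_on_compose2[OF contF])
         (use True in \<open>auto intro!: sub simp: norm_mult\<close>)
    then have int: "integrable lborel (\<lambda>t. indicator {0..2*pi} t *\<^sub>R ?f t)"
      by (intro borel_integrable_compact continuous_intros) auto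
    have "2 * pi * \<bar>Re (F a)\<bar> = \<bar>integral {0..2*pi} (\<lambda>t. Re (F (a + z * cis t)))\<bar>"
      using integral_unique[OF *] by (simp add: abs_mult)
    also have "\<dots> \<le> integral {0..2*pi} ?f"
      using integral_norm_bound_integral[of "\<lambda>t. Re (F (a + z * cis t))" "{0..2*pi}" ?f]
        integrable_continuous_real[of 0 "2*pi" ?f] * cont
      by (auto simp: continuous_intros)
    also have "\<dots> = (LINT t:{0..2*pi}|lborel. ?f t)"
      by (intro set_borel_integral_eq_integral(2)[symmetric]) (use int in \<open>simp add: set_integrable_def\<close>)
    finally have "ennreal (2 * pi * \<bar>Re (F a)\<bar>) \<le> ennreal (LINT t:{0..2*pi}|lborel. ?f t)"
      by (rule ennreal_leI)
    also have "\<dots> = (\<integral>\<^sup>+t. ennreal (indicator {0..2*pi} t *\<^sub>R ?f t) \<partial>lborel)"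
      unfolding set_lebesgue_integral_def using int by (intro nn_integral_eq_integral[symmetric]) auto
    also have "\<dots> = (\<integral>\<^sup>+t. indicator {0..2*pi} t * ennreal (g (cis t * z)) \<partial>lborel)"
      using True by (intro nn_integral_cong) (auto simp: g_def indicator_def norm_mult mult.commute)
    finally show ?thesis using True by (simp add: ennreal_mult)
  qed simp
  have [measurable]: "cis \<in> borel_measurable borel"
    by (intro borel_measurable_continuous_onI continuous_intros)
  have "ennreal (2 * pi) * ennreal (pi * r\<^sup>2 * \<bar>Re (F a)\<bar>)
      = ennreal (2 * pi) * (ennreal \<bar>Re (F a)\<bar> * emeasure lborel (ball (0::complex) r))"
    using r by (simp add: emeasure_ball ennreal_mult' unit_ball_vol_2 mult.commute)
  also have "\<dots> = (\<integral>\<^sup>+z. ennreal (2 * pi) * (ennreal \<bar>Re (F a)\<bar> * indicator (ball (0::complex) r) z) \<partial>lborel)"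
    unfolding mult.assoc[symmetric] by (subst nn_integral_cmult_indicator) auto
  also have "\<dots> \<le> (\<integral>\<^sup>+z. (\<integral>\<^sup>+t. indicator {0..2*pi} t * ennreal (g (cis t * z)) \<partial>lborel) \<partial>lborel)"
    by (intro nn_integral_mono circ)
  also have "\<dots> = (\<integral>\<^sup>+t. (\<integral>\<^sup>+z. indicator {0..2*pi} t * ennreal (g (cis t * z)) \<partial>lborel) \<partial>lborel)"
    by (rule lborel_pair.Fubini') simp
  also have "\<dots> = (\<integral>\<^sup>+t. indicator {0..2*pi} t * (\<integral>\<^sup>+z. ennreal (g z) \<partial>lborel) \<partial>lborel)"
    using nn_integral_rotation[of "\<lambda>z. ennreal (g z)"] by (simp add: nn_integral_cmult)
  also have "\<dots> = ennreal (2 * pi) * (\<integral>\<^sup>+z. ennreal (g z) \<partial>lborel)"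
    by (simp add: nn_integral_multc)
  finally have "ennreal (pi * r\<^sup>2 * \<bar>Re (F a)\<bar>) \<le> (\<integral>\<^sup>+z. ennreal (g z) \<partial>lborel)"
    by (subst (asm) ennreal_mult_le_mult_iff) auto
  also have "\<dots> = (\<integral>\<^sup>+z. ennreal (g (-a + z)) \<partial>lborel)"
    by (subst nn_integral_lborel_translate) auto
  also have "\<dots> = (\<integral>\<^sup>+z. indicator (ball a r) z * ennreal \<bar>Re (F z)\<bar> \<partial>lborel)"
    by (intro nn_integral_cong) (auto simp: g_def indicator_def dist_norm norm_minus_commute)
  finally show ?thesis .
qed


section \<open>Pointwise bounds by integrals of p-th powers\<close>

lemma measurable_indicator_powr:
  fixes f :: "complex \<Rightarrow> real"
  assumes "continuous_on U f" "open U" "0 < p"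
  shows "(\<lambda>z. indicator U z * ennreal (\<bar>f z\<bar> powr p)) \<in> borel_measurable borel"
proof -
  have "continuous_on U (\<lambda>z. \<bar>f z\<bar> powr p)"
    using assms(1,3) by (intro continuous_on_powr' continuous_intros) auto
  then have "(\<lambda>z. indicator U z *\<^sub>R \<bar>f z\<bar> powr p) \<in> borel_measurable borel"
    using assms(2) by (intro borel_measurable_continuous_on_indicator) auto
  then have "(\<lambda>z. ennreal (indicator U z *\<^sub>R \<bar>f z\<bar> powr p)) \<in> borel_measurable borel"
    by measurable
  moreover have "ennreal (indicator U z *\<^sub>R \<bar>f z\<bar> powr p) = indicator U z * ennreal (\<bar>f z\<bar> powr p)" for z
    by (simp add: indicator_def)
  ultimately show ?thesis by (simp only:)
qed

text \<open>Splitting at the level \<open>l\<close>, half of \<open>\<bar>Re (F a)\<bar>\<close>,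
  takes the place of Jensen's inequality: every \<open>x \<ge> 0\<close> is at most
  \<open>l + l powr (1 - p) * x powr p\<close>, and after averaging the constant term absorbs only
  half of the left-hand side. The price is the factor \<open>2 powr p\<close>.\<close>

lemma sub_mean_value_powr_ge1:
  fixes F :: "complex \<Rightarrow> complex"
  assumes hol: "F holomorphic_on S" and S: "open S" "cball a r \<subseteq> S" and r: "0 < r"
    and p: "1 \<le> p" and I: "0 \<le> I"
    and int: "(\<integral>\<^sup>+z. indicator (ball a r) z * ennreal (\<bar>Re (F z)\<bar> powr p) \<partial>lborel) \<le> ennreal I"
  shows "\<bar>Re (F a)\<bar> powr p * (pi * r\<^sup>2) \<le> 2 powr p * I"
proof (cases "Re (F a) = 0")
  case True
  then show ?thesis using I by simp
next
  case False
  define l where "l = \<bar>Re (F a)\<bar> / 2"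
  have l: "0 < l" using False by (simp add: l_def)
  have "ball a r \<subseteq> S" using S ball_subset_cball[of a r] by auto
  then have meas: "(\<lambda>z. indicator (ball a r) z * ennreal (\<bar>Re (F z)\<bar> powr p)) \<in> borel_measurable borel"
    using hol p
    by (intro measurable_indicator_powr continuous_intros holomorphic_on_imp_continuous_on)
      (auto intro: holomorphic_on_subset)
  have meas2: "(\<lambda>z. ennreal l * indicator (ball a r) z) \<in> borel_measurable borel"
    by (intro borel_measurable_times_ennreal borel_measurable_indicator) auto
  have elem: "x \<le> l + l powr (1 - p) * x powr p" if "0 \<le> x" for x
  proof (cases "x \<le> l")
    case True
    then show ?thesis by (simp add: add_increasing2)
  next
    case False
    have "x = x powr (1 - p) * x powr p"
      using False l by (simp flip: powr_add)
    also have "\<dots> \<le> l powr (1 - p) * x powr p"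
      using False l p by (intro mult_right_mono powr_mono2') auto
    finally show ?thesis using l by linarith
  qed
  have "ennreal (pi * r\<^sup>2 * \<bar>Re (F a)\<bar>)
      \<le> (\<integral>\<^sup>+z. indicator (ball a r) z * ennreal \<bar>Re (F z)\<bar> \<partial>lborel)"
    by (rule sub_mean_value[OF hol S r])
  also have "\<dots> \<le> (\<integral>\<^sup>+z. ennreal l * indicator (ball a r) z
      + ennreal (l powr (1 - p)) * (indicator (ball a r) z * ennreal (\<bar>Re (F z)\<bar> powr p)) \<partial>lborel)"
  proof (rule nn_integral_mono)
    fix z
    show "indicator (ball a r) z * ennreal \<bar>Re (F z)\<bar> \<le> ennreal l * indicator (ball a r) z
      + ennreal (l powr (1 - p)) * (indicator (ball a r) z * ennreal (\<bar>Re (F z)\<bar> powr p))"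
      using ennreal_leI[OF elem[of "\<bar>Re (F z)\<bar>"]] l
      by (auto simp: indicator_def ennreal_plus ennreal_mult)
  qed
  also have "\<dots> = ennreal l * emeasure lborel (ball a r)
      + ennreal (l powr (1 - p)) * (\<integral>\<^sup>+z. indicator (ball a r) z * ennreal (\<bar>Re (F z)\<bar> powr p) \<partial>lborel)"
    using meas meas2 by (subst nn_integral_add) (auto simp: nn_integral_cmult nn_integral_cmult_indicator)
  also have "\<dots> \<le> ennreal (l * (pi * r\<^sup>2)) + ennreal (l powr (1 - p)) * ennreal I"
    using r l int by (intro add_mono mult_left_mono) (auto simp: emeasure_ball unit_ball_vol_2 ennreal_mult)
  also have "\<dots> = ennreal (l * (pi * r\<^sup>2) + l powr (1 - p) * I)"
    using l I by (subst ennreal_plus) (auto simp: ennreal_mult)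
  finally have "pi * r\<^sup>2 * \<bar>Re (F a)\<bar> \<le> l * (pi * r\<^sup>2) + l powr (1 - p) * I"
    using l I by (subst (asm) ennreal_le_iff) auto
  then have "l * (pi * r\<^sup>2) \<le> l powr (1 - p) * I"
    by (simp add: l_def field_simps)
  then have "l powr (p - 1) * (l * (pi * r\<^sup>2)) \<le> l powr (p - 1) * (l powr (1 - p) * I)"
    by (intro mult_left_mono) auto
  moreover have "l powr (p - 1) * l = l powr p" "l powr (p - 1) * l powr (1 - p) = 1"
    using l by (simp_all add: powr_diff flip: powr_add)
  ultimately have "l powr p * (pi * r\<^sup>2) \<le> I"
    by (simp flip: mult.assoc)
  moreover have "\<bar>Re (F a)\<bar> powr p = 2 powr p * l powr p"
    by (simp add: l_def powr_divide)
  ultimately show ?thesis by simp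
qed

text \<open>For \<open>p < 1\<close> the function \<open>\<bar>u\<bar> powr p\<close> is not subharmonic. Maximising \<open>\<bar>u\<bar>\<close> against a power of
  the distance to the boundary lets one replace \<open>\<bar>u\<bar>\<close> by \<open>\<bar>u\<bar> powr p\<close> times a constant near a maximum point.\<close>

lemma weighted_max_powr_le1:
  fixes F :: "complex \<Rightarrow> complex"
  assumes hol: "F holomorphic_on S" and S: "open S" "cball c R \<subseteq> S" and R: "0 < R"
    and p: "0 < p" "p < 1" and I: "0 \<le> I"
    and int: "(\<integral>\<^sup>+z. indicator (ball c R) z * ennreal (\<bar>Re (F z)\<bar> powr p) \<partial>lborel) \<le> ennreal I"
    and z: "z \<in> cball c R"
  shows "\<bar>Re (F z)\<bar> powr p * (R - dist c z)\<^sup>2 \<le> 2 powr (2 / p) / pi * I"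
proof -
  \<comment> \<open>The exponent \<open>2 / p\<close> makes \<open>h z powr p\<close> equal to the
    left-hand side of the claim.\<close>
  define h where "h z = (R - dist c z) powr (2 / p) * \<bar>Re (F z)\<bar>" for z
  have contF: "continuous_on (cball c R) F"
    using hol S holomorphic_on_imp_continuous_on continuous_on_subset by blast
  have "continuous_on (cball c R) h"
    unfolding h_def using p contF by (intro continuous_intros continuous_on_powr') auto
  from continuous_attains_sup[OF compact_cball _ this] R
  obtain a where a: "a \<in> cball c R" and max: "\<And>y. y \<in> cball c R \<Longrightarrow> h y \<le> h a" by auto
  define M where "M = h a"
  have M0: "0 \<le> M" by (simp add: M_def h_def)
  have Mp: "M powr p \<le> 2 powr (2 / p) / pi * I"
  proof (cases "M = 0")
    case True
    then show ?thesis using I by simp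
  next
    case False
    \<comment> \<open>Half the distance from the maximum point \<open>a\<close> to the boundary:
      points of \<open>ball a r\<close> keep distance at least \<open>r\<close> from it, so there
      \<open>h y \<le> M\<close> bounds \<open>\<bar>Re (F y)\<bar>\<close> by
      \<open>N\<close>.\<close>
    define r where "r = (R - dist c a) / 2"
    have ua: "Re (F a) \<noteq> 0" using False by (auto simp: M_def h_def)
    have r: "0 < r" using False a by (cases "dist c a = R") (auto simp: M_def h_def r_def)
    have sub: "cball a r \<subseteq> ball c R"
    proof
      fix y assume "y \<in> cball a r"
      then show "y \<in> ball c R"
        using dist_triangle[of c y a] r by (auto simp: r_def)
    qed
    then have subS: "cball a r \<subseteq> S" using S ball_subset_cball[of c R] by (meson subset_trans)
    have sub': "ball a r \<subseteq> ball c R" using sub ball_subset_cball[of a r] by auto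
    define N where "N = M * r powr (- (2 / p))"
    have N: "0 < N" using M0 False r by (simp add: N_def)
    have ball: "\<bar>Re (F y)\<bar> \<le> N powr (1 - p) * \<bar>Re (F y)\<bar> powr p" if "y \<in> ball a r" for y
    proof (cases "Re (F y) = 0")
      case nz: False
      have "r \<le> R - dist c y"
        using dist_triangle[of c y a] that by (auto simp: r_def)
      then have "r powr (2 / p) * \<bar>Re (F y)\<bar> \<le> h y"
        unfolding h_def using r p by (intro mult_right_mono powr_mono2) auto
      also have "\<dots> \<le> M" unfolding M_def using that sub' ball_subset_cball[of c R] by (intro max) auto
      finally have "\<bar>Re (F y)\<bar> \<le> N"
        using r by (simp add: N_def powr_minus field_simps)
      then have "\<bar>Re (F y)\<bar> powr (1 - p) \<le> N powr (1 - p)"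
        using p by (intro powr_mono2) auto
      then have "\<bar>Re (F y)\<bar> powr (1 - p) * \<bar>Re (F y)\<bar> powr p \<le> N powr (1 - p) * \<bar>Re (F y)\<bar> powr p"
        by (intro mult_right_mono) auto
      then show ?thesis using nz by (simp flip: powr_add)
    qed auto
    have meas: "(\<lambda>z. indicator (ball c R) z * ennreal (\<bar>Re (F z)\<bar> powr p)) \<in> borel_measurable borel"
      using contF p continuous_on_subset[OF contF ball_subset_cball]
      by (intro measurable_indicator_powr continuous_intros) auto
    have "ennreal (pi * r\<^sup>2 * \<bar>Re (F a)\<bar>)
        \<le> (\<integral>\<^sup>+z. indicator (ball a r) z * ennreal \<bar>Re (F z)\<bar> \<partial>lborel)"
      by (rule sub_mean_value[OF hol S(1) subS r])
    also have "\<dots> \<le> (\<integral>\<^sup>+z. ennreal (N powr (1 - p)) *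
        (indicator (ball c R) z * ennreal (\<bar>Re (F z)\<bar> powr p)) \<partial>lborel)"
    proof (rule nn_integral_mono)
      fix z
      show "indicator (ball a r) z * ennreal \<bar>Re (F z)\<bar>
          \<le> ennreal (N powr (1 - p)) * (indicator (ball c R) z * ennreal (\<bar>Re (F z)\<bar> powr p))"
        using ennreal_leI[OF ball[of z]] sub'
        by (auto simp: indicator_def ennreal_mult subset_iff)
    qed
    also have "\<dots> = ennreal (N powr (1 - p)) *
        (\<integral>\<^sup>+z. indicator (ball c R) z * ennreal (\<bar>Re (F z)\<bar> powr p) \<partial>lborel)"
      using meas by (simp add: nn_integral_cmult)
    also have "\<dots> \<le> ennreal (N powr (1 - p)) * ennreal I"
      using int by (intro mult_left_mono) auto
    finally have 1: "pi * r\<^sup>2 * \<bar>Re (F a)\<bar> \<le> N powr (1 - p) * I"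
      using I by (simp flip: ennreal_mult)
    have "2 * r = R - dist c a" by (simp add: r_def)
    then have "M = (2 * r) powr (2 / p) * \<bar>Re (F a)\<bar>"
      by (simp only: M_def h_def)
    then have "\<bar>Re (F a)\<bar> = N * 2 powr (- (2 / p))"
      using r by (simp add: N_def powr_mult powr_minus field_simps)
    \<comment> \<open>The factor \<open>N powr (p - 1)\<close> cancels \<open>N powr (1 - p)\<close>
      on the right and leaves \<open>N powr p\<close>, hence \<open>M powr p\<close>, on the
      left.\<close>
    with 1 have 2: "N powr (p - 1) * (pi * r\<^sup>2 * (N * 2 powr (- (2 / p)))) \<le> N powr (p - 1) * (N powr (1 - p) * I)"
      by (intro mult_left_mono) auto
    have e1: "N powr p = N powr (p - 1) * N" and e2: "N powr (p - 1) * N powr (1 - p) = 1"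
      using N by (simp_all add: powr_diff flip: powr_add)
    have "N powr p * r\<^sup>2 * (pi * 2 powr (- (2 / p))) \<le> (N powr (p - 1) * N powr (1 - p)) * I"
      unfolding e1 using 2 by (simp only: mult_ac)
    then have "N powr p * r\<^sup>2 * (pi * 2 powr (- (2 / p))) \<le> I"
      by (simp only: e2 mult_1)
    moreover have "(r powr (- (2 / p))) powr p = inverse (r\<^sup>2)"
    proof -
      have "(r powr (- (2 / p))) powr p = r powr (- 2)" using p by (simp add: powr_powr)
      also have "\<dots> = inverse (r\<^sup>2)" using r by (subst powr_minus) (simp add: powr_numeral)
      finally show ?thesis .
    qed
    then have "N powr p * r\<^sup>2 = M powr p"
      using r by (simp add: N_def powr_mult)
    ultimately show ?thesis by (simp add: powr_minus field_simps)
  qed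
  have "\<bar>Re (F z)\<bar> powr p * (R - dist c z)\<^sup>2 = (h z) powr p"
    using z p by (simp add: h_def powr_mult powr_powr powr_numeral mult.commute)
  also have "\<dots> \<le> M powr p"
    using max[OF z] p by (intro powr_mono2) (auto simp: h_def M_def)
  finally show ?thesis using Mp by linarith
qed

text \<open>For \<open>p \<ge> 1\<close> the mean is taken over the disk of radius
  \<open>R / 4\<close> around \<open>z\<close>. For \<open>p < 1\<close> the weighted bound is used
  with radius \<open>3 * R / 4\<close>, whose closed disk lies in the domain and has
  \<open>z\<close> at least \<open>R / 4\<close> away from its boundary. Both give the factor 16;
  adding the two constants serves every \<open>p\<close>.\<close>

lemma harmonic_powr_bound:
  fixes F :: "complex \<Rightarrow> complex"
  assumes hol: "F holomorphic_on ball c R" and R: "0 < R"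
    and p: "0 < p" and I: "0 \<le> I"
    and int: "(\<integral>\<^sup>+z. indicator (ball c R) z * ennreal (\<bar>Re (F z)\<bar> powr p) \<partial>lborel) \<le> ennreal I"
    and z: "z \<in> ball c (R / 2)"
  shows "\<bar>Re (F z)\<bar> powr p * R\<^sup>2 \<le> 16 * (2 powr p + 2 powr (2 / p)) / pi * I"
proof -
  have mono: "(\<integral>\<^sup>+z. indicator B z * ennreal (\<bar>Re (F z)\<bar> powr p) \<partial>lborel) \<le> ennreal I"
    if "B \<subseteq> ball c R" for B
    using that by (intro order_trans[OF nn_integral_mono int]) (auto simp: indicator_def)
  have pos: "0 \<le> 2 powr p * I" "0 \<le> 2 powr (2 / p) * I" using I by auto
  show ?thesis
  proof (cases "1 \<le> p")
    case True
    have sub: "cball z (R / 4) \<subseteq> ball c R"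
    proof
      fix y assume "y \<in> cball z (R / 4)"
      then show "y \<in> ball c R"
        using dist_triangle[of c y z] z R by auto
    qed
    then have "ball z (R / 4) \<subseteq> ball c R" using ball_subset_cball[of z "R / 4"] by auto
    from mono[OF this] have "\<bar>Re (F z)\<bar> powr p * (pi * (R / 4)\<^sup>2) \<le> 2 powr p * I"
      using R by (intro sub_mean_value_powr_ge1[OF hol _ sub _ True I]) auto
    then show ?thesis using pos by (simp add: field_simps power2_eq_square)
  next
    case False
    have sub: "cball c (3 * R / 4) \<subseteq> ball c R" using R by auto
    then have "ball c (3 * R / 4) \<subseteq> ball c R" using ball_subset_cball[of c "3 * R / 4"] by auto
    from mono[OF this] False have
      1: "\<bar>Re (F z)\<bar> powr p * (3 * R / 4 - dist c z)\<^sup>2 \<le> 2 powr (2 / p) / pi * I"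
      using R p z by (intro weighted_max_powr_le1[OF hol _ sub _ _ _ I]) auto
    have "(R / 4)\<^sup>2 \<le> (3 * R / 4 - dist c z)\<^sup>2"
      using z R by (intro power_mono) auto
    then have "\<bar>Re (F z)\<bar> powr p * (R / 4)\<^sup>2 \<le> 2 powr (2 / p) / pi * I"
      by (intro order_trans[OF mult_left_mono 1]) auto
    then show ?thesis using pos by (simp add: field_simps power2_eq_square)
  qed
qed

text \<open>Cauchy's inequality is applied to \<open>exp (F / B)\<close>, whose modulus lies between \<open>exp (-1)\<close> and
  \<open>exp 1\<close>; this avoids any bound on the imaginary part of \<open>F\<close>.\<close>

lemma deriv_bound_of_Re_bound:
  fixes F :: "complex \<Rightarrow> complex"
  assumes hol: "F holomorphic_on ball c r" and r: "0 < r"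
    and B: "0 \<le> B" "\<And>z. z \<in> ball c r \<Longrightarrow> \<bar>Re (F z)\<bar> \<le> B"
  shows "norm (deriv F c) \<le> 2 * exp 2 * B / r"
proof -
  \<comment> \<open>\<open>E\<close> below requires a positive \<open>b\<close>; the case
    \<open>B = 0\<close> follows by letting \<open>b\<close> tend to 0.\<close>
  have pos: "norm (deriv F c) \<le> 2 * exp 2 * b / r" if b: "0 < b" "B \<le> b" for b
  proof -
    define E where "E z = exp (F z / of_real b)" for z
    have Eb: "norm (E z) \<le> exp 1" if "z \<in> ball c r" for z
      using B(2)[OF that] b by (simp add: E_def norm_exp_eq_Re divide_le_eq abs_le_iff)
    have holE: "E holomorphic_on ball c r"
      unfolding E_def using b by (intro holomorphic_intros hol) auto
    \<comment> \<open>The half radius keeps the closed disk inside the domain and gives the factor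
      2. Dividing \<open>exp 1\<close> by \<open>norm (E c) \<ge> exp (-1)\<close> gives
      \<open>exp 2\<close>.\<close>
    have "norm ((deriv ^^ 1) E c) \<le> fact 1 * exp 1 / (r / 2) ^ 1"
    proof (rule Cauchy_inequality)
      show "E holomorphic_on ball c (r / 2)"
        using r by (intro holomorphic_on_subset[OF holE]) auto
      show "continuous_on (cball c (r / 2)) E"
        using r by (intro holomorphic_on_imp_continuous_on holomorphic_on_subset[OF holE]) auto
    qed (use r in \<open>auto intro!: Eb simp: dist_norm\<close>)
    moreover have "deriv E c = E c * deriv F c / of_real b"
    proof -
      have "(F has_field_derivative deriv F c) (at c)"
        using hol r by (intro holomorphic_derivI) auto
      then have "(E has_field_derivative (E c * (deriv F c / of_real b))) (at c)"
        unfolding E_def using b by (auto intro!: derivative_eq_intros)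
      then show ?thesis by (simp add: DERIV_imp_deriv)
    qed
    moreover have "exp (-1) \<le> norm (E c)"
      using B(2)[of c] b r by (simp add: E_def norm_exp_eq_Re le_divide_eq abs_le_iff)
    ultimately have "exp (-1) * norm (deriv F c) / b \<le> exp 1 * 2 / r"
      using b mult_right_mono[of "exp (-1)" "norm (E c)" "norm (deriv F c) / b"]
      by (simp add: norm_mult norm_divide)
    moreover have "exp 2 = exp 1 * exp (1::real)" by (simp flip: exp_add)
    ultimately show ?thesis using b r by (simp add: exp_minus field_simps)
  qed
  show ?thesis
  proof (cases "B = 0")
    case False
    then show ?thesis using pos[of B] B by simp
  next
    case True
    have "norm (deriv F c) \<le> 0 + e" if "0 < e" for e
      using pos[of "e * r / (2 * exp 2)"] that r True by simp
    then have "norm (deriv F c) \<le> 0" by (rule field_le_epsilon)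
    then show ?thesis using True by simp
  qed
qed

text \<open>\<open>harmonic_powr_bound\<close> supplies a bound \<open>B\<close> for the real part
  on half the radius, with \<open>B powr p\<close> of order \<open>I / R\<^sup>2\<close>. Applying
  \<open>deriv_bound_of_Re_bound\<close> on that smaller disk turns \<open>2 * exp 2\<close> into
  \<open>4 * exp 2\<close>.\<close>

lemma deriv_powr_bound:
  fixes F :: "complex \<Rightarrow> complex"
  assumes hol: "F holomorphic_on ball c R" and R: "0 < R"
    and p: "0 < p" and I: "0 \<le> I"
    and int: "(\<integral>\<^sup>+z. indicator (ball c R) z * ennreal (\<bar>Re (F z)\<bar> powr p) \<partial>lborel) \<le> ennreal I"
  shows "norm (deriv F c) powr p * R powr (p + 2)
    \<le> (4 * exp 2) powr p * (16 * (2 powr p + 2 powr (2 / p)) / pi) * I"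
proof -
  define C where "C = 16 * (2 powr p + 2 powr (2 / p)) / pi"
  define B where "B = (C * I / R\<^sup>2) powr (1 / p)"
  have C: "0 \<le> C" by (simp add: C_def)
  have Bp: "B powr p = C * I / R\<^sup>2"
    using C I p by (simp add: B_def powr_powr)
  have "norm (deriv F c) \<le> 2 * exp 2 * B / (R / 2)"
  proof (rule deriv_bound_of_Re_bound)
    show "F holomorphic_on ball c (R / 2)"
      using R by (intro holomorphic_on_subset[OF hol]) auto
    fix z assume "z \<in> ball c (R / 2)"
    from harmonic_powr_bound[OF hol R p I int this]
    have "\<bar>Re (F z)\<bar> powr p \<le> C * I / R\<^sup>2"
      using R by (simp add: C_def field_simps)
    then have "(\<bar>Re (F z)\<bar> powr p) powr (1 / p) \<le> B"
      unfolding B_def using p by (intro powr_mono2) auto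
    then show "\<bar>Re (F z)\<bar> \<le> B" using p by (simp add: powr_powr)
  qed (use R in \<open>auto simp: B_def\<close>)
  then have "norm (deriv F c) * R \<le> (4 * exp 2) * B"
    using R by (simp add: field_simps)
  then have "(norm (deriv F c) * R) powr p \<le> ((4 * exp 2) * B) powr p"
    using p R by (intro powr_mono2) auto
  also have "\<dots> = (4 * exp 2) powr p * (C * I / R\<^sup>2)"
    by (simp add: powr_mult Bp B_def flip: B_def)
  finally have "norm (deriv F c) powr p * R powr p * R\<^sup>2 \<le> (4 * exp 2) powr p * (C * I)"
    using R by (simp add: powr_mult field_simps)
  then show ?thesis using R by (simp add: powr_add C_def mult_ac powr_numeral)
qed

subsection \<open>The kernel of the radial path integral\<close>

text \<open>Directions are compared by chordal distance instead of angle. As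
  \<open>sgn 0 = 0\<close>, the area bounds below assume only \<open>norm e \<le> 1\<close>, which
  covers \<open>e = sgn 0\<close>.\<close>

definition sector :: "complex \<Rightarrow> real \<Rightarrow> real \<Rightarrow> complex set" where
  "sector e k s = {z \<in> ball 0 s. norm (sgn z - e) \<le> k}"

lemma borel_measurable_sgn_complex [measurable]: "(sgn :: complex \<Rightarrow> complex) \<in> borel_measurable borel"
  unfolding sgn_div_norm by measurable

lemma sets_sector [measurable]: "sector e k s \<in> sets borel"
proof -
  have "sector e k s = {z. norm z < s \<and> norm (sgn z - e) \<le> k}"
    by (auto simp: sector_def)
  also have "\<dots> \<in> sets borel" by measurable
  finally show ?thesis .
qed

text \<open>The sector is covered by about \<open>1 / k\<close> disks of radius \<open>2 * k\<close> centred on the segment from \<open>0\<close> to \<open>e\<close>.\<close>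

lemma emeasure_sector_1:
  assumes e: "norm e \<le> 1" and k: "0 < k"
  shows "emeasure lborel (sector e k 1) \<le> ennreal (4 * pi * k * (1 + 2 * k))"
proof -
  define N where "N = nat \<lfloor>1 / k\<rfloor>"
  have "sector e k 1 \<subseteq> (\<Union>j\<in>{..N}. cball (of_real (real j * k) * e) (2 * k))"
  proof
    fix z assume "z \<in> sector e k 1"
    then have z: "norm z < 1" "norm (sgn z - e) \<le> k" by (auto simp: sector_def)
    \<comment> \<open>\<open>real j * k\<close> is the last multiple of \<open>k\<close> up to
      \<open>norm z\<close>. Turning \<open>z\<close> into the direction \<open>e\<close> and then
      sliding to this centre costs at most \<open>k\<close> each.\<close>
    define j where "j = nat \<lfloor>norm z / k\<rfloor>"
    have "j \<le> N" unfolding j_def N_def using z k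
      by (intro nat_mono floor_mono divide_right_mono) auto
    have j: "real j * k \<le> norm z" "norm z \<le> real j * k + k"
    proof -
      have "real j = of_int \<lfloor>norm z / k\<rfloor>" using k by (simp add: j_def)
      then have "real j \<le> norm z / k" "norm z / k \<le> real j + 1" by linarith+
      then show "real j * k \<le> norm z" "norm z \<le> real j * k + k"
        using k by (simp_all add: field_simps)
    qed
    have polar: "of_real (norm z) * sgn z = z"
      by (cases "z = 0") (simp_all add: sgn_div_norm scaleR_conv_of_real)
    have "z - of_real (real j * k) * e = of_real (norm z) * (sgn z - e) + of_real (norm z - real j * k) * e"
      by (simp only: right_diff_distrib left_diff_distrib polar of_real_diff) simp
    also have "norm \<dots> \<le> norm z * norm (sgn z - e) + \<bar>norm z - real j * k\<bar> * norm e"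
      using norm_triangle_ineq[of "of_real (norm z) * (sgn z - e)" "of_real (norm z - real j * k) * e"]
      by (simp only: norm_mult norm_of_real abs_norm_cancel)
    also have "\<dots> \<le> 1 * k + k * 1"
      using z j e k by (intro add_mono mult_mono) auto
    finally show "z \<in> (\<Union>j\<in>{..N}. cball (of_real (real j * k) * e) (2 * k))"
      using \<open>j \<le> N\<close> by (auto simp: dist_norm norm_minus_commute intro!: bexI[of _ j])
  qed
  then have "emeasure lborel (sector e k 1)
      \<le> (\<Sum>j\<in>{..N}. emeasure lborel (cball (of_real (real j * k) * e) (2 * k)))"
    by (intro order_trans[OF emeasure_mono emeasure_subadditive_finite]) auto
  also have "\<dots> = ennreal (real (N + 1) * (pi * (2 * k)\<^sup>2))"
    using k by (simp add: emeasure_cball unit_ball_vol_2 ennreal_mult'' flip: ennreal_of_nat_eq_real_of_nat)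
  also have "\<dots> \<le> ennreal (4 * pi * k * (1 + 2 * k))"
  proof (rule ennreal_leI)
    have "real N \<le> 1 / k" using k by (simp add: N_def)
    then have "real (N + 1) * k \<le> 1 + 2 * k" using k by (simp add: field_simps)
    from mult_left_mono[OF this, of "4 * pi * k"]
    show "real (N + 1) * (pi * (2 * k)\<^sup>2) \<le> 4 * pi * k * (1 + 2 * k)"
      using k by (simp add: power2_eq_square mult_ac)
  qed
  finally show ?thesis .
qed

text \<open>\<open>sgn\<close> is invariant under positive dilations, so the sectors are dilates of
  each other. An exact scaling law, not just an upper bound, is what lets
  \<open>emeasure_sector_shell\<close> subtract two sectors.\<close>

lemma emeasure_sector:
  assumes "0 \<le> s"
  shows "emeasure lborel (sector e k s) = ennreal (s\<^sup>2) * emeasure lborel (sector e k 1)"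
proof (cases "s = 0")
  case True
  then show ?thesis by (simp add: sector_def)
next
  case False
  with assms have s: "0 < s" by simp
  have "sector e k s = (\<lambda>x. 0 + s *\<^sub>R x) ` sector e k 1"
  proof (intro equalityI subsetI)
    fix z assume z: "z \<in> sector e k s"
    then have "z /\<^sub>R s \<in> sector e k 1"
      using s by (simp add: sector_def sgn_scaleR field_simps)
    then show "z \<in> (\<lambda>x. 0 + s *\<^sub>R x) ` sector e k 1"
      using s by (intro image_eqI[of _ _ "z /\<^sub>R s"]) auto
  qed (use s in \<open>auto simp: sector_def sgn_scaleR\<close>)
  then have "emeasure lebesgue (sector e k s) = \<bar>s\<bar> ^ DIM(complex) * emeasure lebesgue (sector e k 1)"
    using emeasure_lebesgue_affine[of s 0 "sector e k 1"] by simp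
  then have "emeasure lebesgue (sector e k s) = ennreal (s\<^sup>2) * emeasure lebesgue (sector e k 1)"
    using s by (simp only: DIM_complex abs_of_pos)
  moreover have "emeasure lebesgue (sector e k x) = emeasure lborel (sector e k x)" for x by simp
  ultimately show ?thesis by (simp only:)
qed

text \<open>The shell lies in the difference of two sectors of equal opening, with area
  \<open>(t\<^sup>2 - s\<^sup>2) * m\<close>; factoring the difference of squares makes it linear in
  the thickness \<open>b - a\<close>. Truncating the radii at 0 covers \<open>a\<close> or
  \<open>b\<close> above 1.\<close>

lemma emeasure_sector_shell:
  fixes e :: complex
  assumes e: "norm e \<le> 1" and k: "0 < k" and ab: "0 \<le> a" "a \<le> b"
  shows "emeasure lborel {z \<in> ball 0 1. a < 1 - norm z \<and> 1 - norm z \<le> b \<and> norm (sgn z - e) \<le> k}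
    \<le> ennreal (2 * (b - a) * (4 * pi * k * (1 + 2 * k)))" (is "emeasure lborel ?T \<le> _")
proof -
  define s t where "s = max 0 (1 - b)" and "t = max 0 (1 - a)"
  have st: "0 \<le> s" "s \<le> t" using ab by (auto simp: s_def t_def)
  obtain m where m: "emeasure lborel (sector e k 1) = ennreal m" "0 \<le> m" "m \<le> 4 * pi * k * (1 + 2 * k)"
    using emeasure_sector_1[OF e k] k
    by (cases "emeasure lborel (sector e k 1)") (auto simp: ennreal_le_iff top_unique)
  have es: "emeasure lborel (sector e k s) = ennreal (s\<^sup>2 * m)"
    and et: "emeasure lborel (sector e k t) = ennreal (t\<^sup>2 * m)"
    using emeasure_sector[of s e k] emeasure_sector[of t e k] st m by (simp_all add: ennreal_mult)
  have sub: "sector e k s \<subseteq> sector e k t" using st by (auto simp: sector_def)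
  have "?T \<subseteq> sector e k t - sector e k s"
  proof
    fix z assume "z \<in> ?T"
    then show "z \<in> sector e k t - sector e k s"
      by (auto simp: sector_def s_def t_def less_max_iff_disj not_less)
  qed
  then have "emeasure lborel ?T \<le> emeasure lborel (sector e k t - sector e k s)"
    by (intro emeasure_mono) auto
  also have "\<dots> = emeasure lborel (sector e k t) - emeasure lborel (sector e k s)"
    using sub es by (intro emeasure_Diff) auto
  also have "\<dots> = ennreal ((t\<^sup>2 - s\<^sup>2) * m)"
    using m es et by (simp add: ennreal_minus left_diff_distrib)
  also have "\<dots> \<le> ennreal (2 * (b - a) * (4 * pi * k * (1 + 2 * k)))"
  proof (intro ennreal_leI mult_mono)
    have "t\<^sup>2 - s\<^sup>2 = (t + s) * (t - s)" by (simp add: power2_eq_square algebra_simps)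
    also have "\<dots> \<le> 2 * (b - a)"
      using st ab by (intro mult_mono) (auto simp: s_def t_def)
    finally show "t\<^sup>2 - s\<^sup>2 \<le> 2 * (b - a)" .
  qed (use m ab in auto)
  finally show ?thesis .
qed

text \<open>Walk from \<open>z\<close> towards \<open>0\<close>, doubling the distance to the circle at each step. The step that starts at
  distance \<open>r = q * (1 - norm z)\<close>, \<open>q = 2 ^ i\<close>, is controlled by disks of radius \<open>r / 2\<close> around points of
  the path; for every \<open>w\<close> in such a disk \<open>(z, w)\<close> lies in \<open>shadow q\<close>.\<close>

definition shadow :: "real \<Rightarrow> (complex \<times> complex) set" where
  "shadow q = {(z, w). norm z < 1 \<and> norm w < 1 \<and> 1 - norm w < 3 * (q * (1 - norm z)) \<and>
     q * (1 - norm z) \<le> 2 * (1 - norm w) \<and> norm (sgn z - sgn w) \<le> 7 * (1 - norm w)}"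

lemma sets_shadow [measurable]: "shadow q \<in> sets (borel \<Otimes>\<^sub>M borel)"
proof -
  have "shadow q = {x \<in> space (borel \<Otimes>\<^sub>M borel). norm (fst x) < 1 \<and> norm (snd x) < 1 \<and>
      1 - norm (snd x) < 3 * (q * (1 - norm (fst x))) \<and>
      q * (1 - norm (fst x)) \<le> 2 * (1 - norm (snd x)) \<and>
      norm (sgn (fst x) - sgn (snd x)) \<le> 7 * (1 - norm (snd x))}"
    by (auto simp: shadow_def space_pair_measure)
  also have "\<dots> \<in> sets (borel \<Otimes>\<^sub>M borel)" by measurable
  finally show ?thesis .
qed

text \<open>With \<open>r = 1 - norm w\<close>, this is a shell of thickness
  \<open>5 / 3 * r / q\<close> and opening \<open>7 * r\<close>. Since
  \<open>1 + 14 * r \<le> 15\<close>, the constant is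
  \<open>2 * 5 / 3 * 4 * 7 * 15 = 1400\<close>.\<close>

lemma emeasure_shadow:
  assumes w: "norm w < 1" and q: "0 < q"
  shows "emeasure lborel {z. (z, w) \<in> shadow q} \<le> ennreal (1400 * pi * (1 - norm w)\<^sup>2 / q)"
proof -
  define r where "r = 1 - norm w"
  have r: "0 < r" "r \<le> 1" using w by (auto simp: r_def)
  have "{z. (z, w) \<in> shadow q} = {z \<in> ball 0 1. r / (3 * q) < 1 - norm z \<and> 1 - norm z \<le> 2 * r / q \<and>
      norm (sgn z - sgn w) \<le> 7 * r}"
    using q w by (auto simp: shadow_def r_def field_simps)
  also have "emeasure lborel \<dots> \<le> ennreal (2 * (2 * r / q - r / (3 * q)) * (4 * pi * (7 * r) * (1 + 2 * (7 * r))))"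
    using r q by (intro emeasure_sector_shell) (auto simp: field_simps norm_sgn)
  also have "\<dots> \<le> ennreal (2 * (2 * r / q - r / (3 * q)) * (4 * pi * (7 * r) * 15))"
    using r q by (intro ennreal_leI mult_left_mono) (auto simp: field_simps)
  also have "2 * (2 * r / q - r / (3 * q)) * (4 * pi * (7 * r) * 15) = 1400 * pi * r\<^sup>2 / q"
    using q by (simp add: field_simps power2_eq_square)
  finally show ?thesis by (simp add: r_def)
qed

text \<open>Valid for all \<open>p > 0\<close>, in place of the Hoelder inequality or subadditivity: compare each term with the largest
  value of \<open>\<sigma> powr (i / p) * a i\<close>.\<close>

lemma sum_powr_le:
  fixes a :: "nat \<Rightarrow> real"
  assumes p: "0 < p" and \<sigma>: "1 < \<sigma>" and a: "\<And>i. 0 \<le> a i"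
  shows "(\<Sum>i\<le>m. a i) powr p \<le> (1 / (1 - \<sigma> powr (- 1 / p))) powr p * (\<Sum>i\<le>m. \<sigma> ^ i * a i powr p)"
proof -
  \<comment> \<open>Chosen so that \<open>(s ^ j) powr p\<close> is the inverse of
    \<open>\<sigma> ^ j\<close>. The sum is then at most \<open>b\<close> times a geometric series
    in \<open>s\<close>, while \<open>b powr p\<close> is a single term of the right-hand
    side.\<close>
  define s where "s = \<sigma> powr (- 1 / p)"
  have s: "0 < s" "s < 1" using p \<sigma> by (auto simp: s_def intro!: powr_less_one)
  define f where "f i = a i / s ^ i" for i
  define b where "b = Max (f ` {..m})"
  have "b \<in> f ` {..m}" unfolding b_def by (intro Max_in) auto
  then obtain j where j: "j \<le> m" "b = f j" by auto
  have b: "f i \<le> b" if "i \<le> m" for i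
    using that by (auto simp: b_def)
  have b0: "0 \<le> b" using j a s by (simp add: f_def)
  have "(\<Sum>i\<le>m. a i) \<le> (\<Sum>i\<le>m. b * s ^ i)"
    using b s by (intro sum_mono) (auto simp: f_def field_simps)
  also have "\<dots> \<le> b * (1 / (1 - s))"
  proof -
    have "(\<Sum>i\<le>m. s ^ i) \<le> (\<Sum>i. s ^ i)"
      using s by (intro sum_le_suminf summable_geometric) auto
    also have "\<dots> = 1 / (1 - s)" using s by (intro suminf_geometric) auto
    finally show ?thesis using mult_left_mono[OF _ b0] by (simp only: flip: sum_distrib_left)
  qed
  finally have "(\<Sum>i\<le>m. a i) powr p \<le> (b * (1 / (1 - s))) powr p"
    using p a by (intro powr_mono2 sum_nonneg) auto
  also have "\<dots> = (1 / (1 - s)) powr p * b powr p"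
    by (subst mult.commute) (rule powr_mult)
  also have "b powr p = \<sigma> ^ j * a j powr p"
  proof -
    have "(s ^ j) powr p = inverse (\<sigma> ^ j)"
    proof -
      have "(s ^ j) powr p = s powr (real j * p)"
        using s by (simp add: powr_powr flip: powr_realpow)
      also have "\<dots> = \<sigma> powr (- real j)"
        using p by (simp add: s_def powr_powr)
      also have "\<dots> = inverse (\<sigma> ^ j)"
        using \<sigma> by (simp add: powr_minus powr_realpow)
      finally show ?thesis .
    qed
    then show ?thesis using j by (simp add: f_def powr_divide) (simp add: divide_inverse mult.commute)
  qed
  also have "\<dots> \<le> (\<Sum>i\<le>m. \<sigma> ^ i * a i powr p)"
    using j \<sigma> by (intro member_le_sum[where f = "\<lambda>i. \<sigma> ^ i * a i powr p"]) auto
  finally show ?thesis by (simp add: s_def mult_left_mono)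
qed


section \<open>Increments along a radius\<close>

definition deriv_const :: "real \<Rightarrow> real" where
  "deriv_const p = (4 * exp 2) powr p * (16 * (2 powr p + 2 powr (2 / p)) / pi)"

lemma deriv_const_nonneg: "0 \<le> deriv_const p"
  by (simp add: deriv_const_def)

text \<open>Fixes the constants of \<open>shadow\<close>, where \<open>e = sgn z\<close> and
  \<open>r = q * (1 - norm z)\<close>. The centre is at distance \<open>t\<close> between
  \<open>r\<close> and \<open>2 * r\<close> from the circle, so points of the ball are at distance
  between \<open>r / 2\<close> and \<open>5 / 2 * r\<close>.\<close>

lemma ball_subset_shadow:
  fixes e w :: complex
  assumes e: "norm e = 1" and r: "0 < r" "r \<le> t" "t \<le> 2 * r" "t \<le> 1"
    and w: "w \<in> ball ((1 - t) *\<^sub>R e) (r / 2)"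
  shows "norm w < 1" "1 - norm w < 3 * r" "r \<le> 2 * (1 - norm w)" "norm (e - sgn w) \<le> 7 * (1 - norm w)"
proof -
  define n where "n = (1 - t) *\<^sub>R e"
  have n: "norm n = 1 - t" using e r by (simp add: n_def)
  have d: "norm (w - n) < r / 2" using w by (simp add: n_def dist_norm norm_minus_commute)
  have "norm w \<le> norm n + norm (w - n)" using norm_triangle_ineq[of n "w - n"] by simp
  then have 1: "r / 2 < 1 - norm w" using d n r by linarith
  have "norm n \<le> norm w + norm (w - n)" using norm_triangle_ineq[of w "n - w"] by (simp add: norm_minus_commute)
  then have 2: "1 - norm w < 5 / 2 * r" using d n r by linarith
  show "norm w < 1" "1 - norm w < 3 * r" "r \<le> 2 * (1 - norm w)"
    using 1 2 r by (auto simp: field_simps)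
  show "norm (e - sgn w) \<le> 7 * (1 - norm w)"
  proof (cases "w = 0")
    case True
    then show ?thesis using e by simp
  next
    case False
    have "e - n = t *\<^sub>R e" by (simp add: n_def algebra_simps)
    then have 3: "norm (e - n) = t" using e r by simp
    have "w - sgn w = (norm w - 1) *\<^sub>R sgn w"
      using False by (simp add: sgn_div_norm algebra_simps)
    then have 4: "norm (w - sgn w) = 1 - norm w"
      using False 1 r by (simp add: norm_sgn)
    have "e - sgn w = (e - n) + ((n - w) + (w - sgn w))" by simp
    \<comment> \<open>The first two distances are at most \<open>2 * r\<close> and
      \<open>r / 2\<close>. Since \<open>r < 2 * (1 - norm w)\<close>, the total is below
      \<open>6 * (1 - norm w)\<close>.\<close>
    then have "norm (e - sgn w) \<le> norm (e - n) + (norm (n - w) + norm (w - sgn w))"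
      by (metis norm_triangle_le norm_triangle_mono order_refl)
    then show ?thesis using 1 3 4 d r by (simp add: norm_minus_commute)
  qed
qed

text \<open>The mean value inequality on the segment. Around each of its points the disk of radius
  \<open>r / 2\<close> lies in the region of the assumed integral, so
  \<open>deriv_powr_bound\<close> bounds \<open>norm (deriv F z)\<close> uniformly by
  \<open>G\<close>; the length is \<open>s - r \<le> r\<close>. Allowing \<open>s < 2 * r\<close>
  admits the shortened last step of the path.\<close>

lemma radial_step_bound:
  fixes F :: "complex \<Rightarrow> complex" and v :: "complex \<Rightarrow> real"
  assumes hol: "F holomorphic_on ball 0 1"
    and v: "\<And>z. z \<in> ball 0 1 \<Longrightarrow> (v has_derivative v' z) (at z)"
    and v': "\<And>z h. z \<in> ball 0 1 \<Longrightarrow> \<bar>v' z h\<bar> \<le> K * norm (deriv F z) * norm h"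
    and K: "0 \<le> K" and p: "0 < p" and I: "0 \<le> I"
    and e: "norm e = 1" and r: "0 < r" "r \<le> s" "s \<le> 2 * r" "s \<le> 1"
    and int: "(\<integral>\<^sup>+w. indicator {w. norm w < 1 \<and> 1 - norm w < 3 * r \<and> r \<le> 2 * (1 - norm w) \<and>
        norm (e - sgn w) \<le> 7 * (1 - norm w)} w * ennreal (\<bar>Re (F w)\<bar> powr p) \<partial>lborel) \<le> ennreal I"
  shows "\<bar>v ((1 - r) *\<^sub>R e) - v ((1 - s) *\<^sub>R e)\<bar> powr p
    \<le> K powr p * deriv_const p * 2 powr (p + 2) * I / r\<^sup>2"
proof -
  define G where "G = (deriv_const p * I / (r / 2) powr (p + 2)) powr (1 / p)"
  have G0: "0 \<le> G" by (simp add: G_def)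
  have Gp: "G powr p = deriv_const p * I / (r / 2) powr (p + 2)"
    using p I deriv_const_nonneg[of p] by (simp add: G_def powr_powr)
  let ?S = "closed_segment ((1 - s) *\<^sub>R e) ((1 - r) *\<^sub>R e)"
  have seg: "\<exists>t. r \<le> t \<and> t \<le> s \<and> z = (1 - t) *\<^sub>R e" if "z \<in> ?S" for z
  proof -
    obtain x where x: "0 \<le> x" "x \<le> 1" "z = (1 - x) *\<^sub>R (1 - s) *\<^sub>R e + x *\<^sub>R (1 - r) *\<^sub>R e"
      using \<open>z \<in> ?S\<close> by (auto simp: closed_segment_def)
    have "z = ((1 - x) * (1 - s) + x * (1 - r)) *\<^sub>R e"
      using x(3) by (simp only: scaleR_add_left scaleR_scaleR)
    also have "(1 - x) * (1 - s) + x * (1 - r) = 1 - (s - x * (s - r))" by (simp add: algebra_simps)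
    finally have "z = (1 - (s - x * (s - r))) *\<^sub>R e" .
    moreover have "x * (s - r) \<le> 1 * (s - r)"
      using x r by (intro mult_right_mono) auto
    moreover have "0 \<le> x * (s - r)" using x r by simp
    ultimately show ?thesis by (intro exI[of _ "s - x * (s - r)"]) auto
  qed
  have inball: "z \<in> ball 0 1" if z: "z \<in> ?S" for z
  proof -
    obtain t where t: "r \<le> t" "t \<le> s" "z = (1 - t) *\<^sub>R e" using seg[OF z] by blast
    show ?thesis using t e r by simp
  qed
  have F': "norm (deriv F z) \<le> G" if z: "z \<in> ?S" for z
  proof -
    obtain t where t: "r \<le> t" "t \<le> s" "z = (1 - t) *\<^sub>R e" using seg[OF z] by blast
    have sub: "norm w < 1" "1 - norm w < 3 * r" "r \<le> 2 * (1 - norm w)" "norm (e - sgn w) \<le> 7 * (1 - norm w)"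
      if "w \<in> ball z (r / 2)" for w
      using ball_subset_shadow[of e r t w] that e t r by auto
    have "(\<integral>\<^sup>+w. indicator (ball z (r / 2)) w * ennreal (\<bar>Re (F w)\<bar> powr p) \<partial>lborel) \<le> ennreal I"
      using sub by (intro order_trans[OF nn_integral_mono int]) (auto simp: indicator_def)
    moreover have "F holomorphic_on ball z (r / 2)"
      using sub by (intro holomorphic_on_subset[OF hol]) auto
    ultimately have "norm (deriv F z) powr p * (r / 2) powr (p + 2) \<le> deriv_const p * I"
      unfolding deriv_const_def using r p I by (intro deriv_powr_bound) auto
    then have "norm (deriv F z) powr p \<le> deriv_const p * I / (r / 2) powr (p + 2)"
      using r by (simp add: field_simps)
    then have "(norm (deriv F z) powr p) powr (1 / p) \<le> G"
      unfolding G_def using p by (intro powr_mono2) auto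
    then show ?thesis using p by (simp add: powr_powr)
  qed
  have "norm (v ((1 - r) *\<^sub>R e) - v ((1 - s) *\<^sub>R e)) \<le> (K * G) * norm ((1 - r) *\<^sub>R e - (1 - s) *\<^sub>R e)"
  proof (rule differentiable_bound[where S = ?S and f' = v'])
    fix z assume z: "z \<in> ?S"
    show "(v has_derivative v' z) (at z within ?S)"
      using v[OF inball[OF z]] has_derivative_at_withinI by blast
    show "onorm (v' z) \<le> K * G"
    proof (rule onorm_bound)
      show "0 \<le> K * G" using K G0 by simp
      fix h
      have "\<bar>v' z h\<bar> \<le> K * norm (deriv F z) * norm h" by (rule v'[OF inball[OF z]])
      also have "\<dots> \<le> K * G * norm h"
        using K F'[OF z] by (intro mult_right_mono mult_left_mono) auto
      finally show "norm (v' z h) \<le> K * G * norm h" by simp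
    qed
  qed auto
  also have "norm ((1 - r) *\<^sub>R e - (1 - s) *\<^sub>R e) = s - r"
    using e r by (simp flip: scaleR_left_diff_distrib)
  also have "K * G * (s - r) \<le> K * G * r"
    using r K G0 by (intro mult_left_mono) auto
  finally have "\<bar>v ((1 - r) *\<^sub>R e) - v ((1 - s) *\<^sub>R e)\<bar> powr p \<le> (K * G * r) powr p"
    using p by (intro powr_mono2) auto
  also have "\<dots> = K powr p * (deriv_const p * I / (r / 2) powr (p + 2)) * r powr p"
    by (simp add: powr_mult Gp)
  \<comment> \<open>\<open>r powr p\<close> from the length of the segment cancels against
    \<open>(r / 2) powr (p + 2)\<close>, leaving \<open>1 / r\<^sup>2\<close>.\<close>
  also have "\<dots> = K powr p * deriv_const p * 2 powr (p + 2) * I / r\<^sup>2"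
    using r by (simp add: powr_divide powr_add powr_numeral field_simps)
  finally show ?thesis .
qed

text \<open>The increments telescope. The \<open>min 1\<close> makes the last doubling stop exactly
  at the origin, where \<open>v\<close> vanishes.\<close>

lemma radial_chain:
  fixes v :: "complex \<Rightarrow> real"
  assumes z: "norm z < 1" and v0: "v 0 = 0"
  obtains m where "2 ^ m * (1 - norm z) \<le> 1"
    "\<bar>v z\<bar> \<le> (\<Sum>i\<le>m. \<bar>v ((1 - 2 ^ i * (1 - norm z)) *\<^sub>R sgn z)
       - v ((1 - min 1 (2 ^ Suc i * (1 - norm z))) *\<^sub>R sgn z)\<bar>)"
proof -
  define d where "d = 1 - norm z"
  have d: "0 < d" "d \<le> 1" using z by (auto simp: d_def)
  obtain n where "1 / d < 2 ^ n" using real_arch_pow[of 2 "1 / d"] by auto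
  then have n: "1 < 2 ^ n * d" using d by (simp add: field_simps)
  define N where "N = (LEAST n. 1 < 2 ^ n * d)"
  have N: "1 < 2 ^ N * d" unfolding N_def using n by (rule LeastI)
  have less: "2 ^ i * d \<le> 1" if "i < N" for i
    using not_less_Least[of i "\<lambda>n. 1 < 2 ^ n * d"] that by (simp add: N_def)
  \<comment> \<open>At exponent 0 the distance is \<open>d \<le> 1\<close>, so at least one step is
    made and \<open>m = N - 1\<close> exists.\<close>
  have "N \<noteq> 0" using N d by (cases N) auto
  then obtain m where m: "N = Suc m" by (cases N) auto
  define g where "g i = v ((1 - min 1 (2 ^ i * d)) *\<^sub>R sgn z)" for i
  have "norm z *\<^sub>R sgn z = z" by (cases "z = 0") (auto simp: sgn_div_norm)
  then have g0: "g 0 = v z" using d by (simp add: g_def) (simp add: d_def)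
  have gN: "g (Suc m) = 0" using N m v0 by (simp add: g_def)
  have "v z = (\<Sum>i<Suc m. g i - g (Suc i))"
    by (simp only: sum_lessThan_telescope' g0 gN diff_zero)
  then have "\<bar>v z\<bar> \<le> (\<Sum>i\<le>m. \<bar>g i - g (Suc i)\<bar>)"
    by (simp only: lessThan_Suc_atMost sum_abs)
  also have "\<dots> = (\<Sum>i\<le>m. \<bar>v ((1 - 2 ^ i * d) *\<^sub>R sgn z) - g (Suc i)\<bar>)"
    using less m by (intro sum.cong) (auto simp: g_def)
  finally show ?thesis
    using less[of m] m by (intro that[of m]) (auto simp: g_def d_def)
qed


section \<open>Summation over the dyadic scales\<close>

definition path_const :: "real \<Rightarrow> real \<Rightarrow> real" where
  "path_const p K = (1 / (1 - (3 / 2) powr (- 1 / p))) powr p * 9 * (K powr p * deriv_const p * 2 powr (p + 2))"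

lemma path_const_nonneg: "0 \<le> path_const p K"
  by (simp add: path_const_def deriv_const_nonneg)

text \<open>After Tonelli the inner integral is the area from \<open>emeasure_shadow\<close>; its
  factor \<open>(1 - norm w)\<^sup>2\<close> cancels the weight, and the gain \<open>1 / q\<close>
  remains.\<close>

lemma nn_integral_shadow:
  fixes f :: "complex \<Rightarrow> ennreal"
  assumes f[measurable]: "f \<in> borel_measurable borel"
    and f0: "\<And>w. 1 \<le> norm w \<Longrightarrow> f w = 0" and q: "0 < q"
  shows "(\<integral>\<^sup>+z. \<integral>\<^sup>+w. indicator (shadow q) (z, w) * (ennreal (1 / (1 - norm w)\<^sup>2) * f w) \<partial>lborel \<partial>lborel)
    \<le> ennreal (1400 * pi / q) * (\<integral>\<^sup>+w. f w \<partial>lborel)"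
proof -
  define Q where "Q w = ennreal (1 / (1 - norm w)\<^sup>2) * f w" for w
  have [measurable]: "Q \<in> borel_measurable borel" unfolding Q_def by measurable
  have "(\<integral>\<^sup>+z. \<integral>\<^sup>+w. indicator (shadow q) (z, w) * Q w \<partial>lborel \<partial>lborel)
      = (\<integral>\<^sup>+w. \<integral>\<^sup>+z. indicator (shadow q) (z, w) * Q w \<partial>lborel \<partial>lborel)"
    by (rule lborel_pair.Fubini'[symmetric]) measurable
  also have "\<dots> \<le> (\<integral>\<^sup>+w. ennreal (1400 * pi / q) * f w \<partial>lborel)"
  proof (rule nn_integral_mono)
    fix w :: complex
    have meas: "{z. (z, w) \<in> shadow q} \<in> sets borel"
      using sets_Pair2[OF sets_shadow[of q], of w] by (simp add: vimage_def)
    have "(\<integral>\<^sup>+z. indicator (shadow q) (z, w) * Q w \<partial>lborel)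
        = (\<integral>\<^sup>+z. Q w * indicator {z. (z, w) \<in> shadow q} z \<partial>lborel)"
      by (intro nn_integral_cong) (auto simp: indicator_def)
    also have "\<dots> = Q w * emeasure lborel {z. (z, w) \<in> shadow q}"
      using meas by (subst nn_integral_cmult_indicator) auto
    also have "\<dots> \<le> ennreal (1400 * pi / q) * f w"
    proof (cases "norm w < 1")
      case True
      have "Q w * emeasure lborel {z. (z, w) \<in> shadow q}
          \<le> Q w * ennreal (1400 * pi * (1 - norm w)\<^sup>2 / q)"
        by (intro mult_left_mono emeasure_shadow True q) simp
      also have "\<dots> = ennreal (1 / (1 - norm w)\<^sup>2) * ennreal (1400 * pi * (1 - norm w)\<^sup>2 / q) * f w"
        by (simp add: Q_def mult_ac)
      also have "ennreal (1 / (1 - norm w)\<^sup>2) * ennreal (1400 * pi * (1 - norm w)\<^sup>2 / q)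
          = ennreal (1400 * pi / q)"
        using True q by (subst ennreal_mult[symmetric]) auto
      finally show ?thesis .
    qed (simp add: Q_def f0)
    finally show "(\<integral>\<^sup>+z. indicator (shadow q) (z, w) * Q w \<partial>lborel) \<le> ennreal (1400 * pi / q) * f w" .
  qed
  also have "\<dots> = ennreal (1400 * pi / q) * (\<integral>\<^sup>+w. f w \<partial>lborel)"
    by (simp add: nn_integral_cmult)
  finally show ?thesis unfolding Q_def .
qed

text \<open>Each increment of \<open>radial_chain\<close> is estimated by
  \<open>radial_step_bound\<close>, its region being the section of \<open>shadow (2 ^ i)\<close> at
  \<open>z\<close>. On that section \<open>1 - norm w < 3 * r\<close>, so
  \<open>1 / r\<^sup>2\<close> may be traded for \<open>9 / (1 - norm w)\<^sup>2\<close>, a weight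
  free of \<open>z\<close>. The number of steps depends on \<open>z\<close>; the full series removes
  this dependence.\<close>

lemma pointwise_shadow_bound:
  fixes F :: "complex \<Rightarrow> complex" and v :: "complex \<Rightarrow> real"
  assumes hol: "F holomorphic_on ball 0 1"
    and v: "\<And>z. z \<in> ball 0 1 \<Longrightarrow> (v has_derivative v' z) (at z)"
    and v': "\<And>z h. z \<in> ball 0 1 \<Longrightarrow> \<bar>v' z h\<bar> \<le> K * norm (deriv F z) * norm h"
    and K: "0 \<le> K" and p: "0 < p" and v0: "v 0 = 0"
    and P: "\<And>w. P w = indicator (ball 0 1) w * ennreal (\<bar>Re (F w)\<bar> powr p)"
    and P_meas[measurable]: "P \<in> borel_measurable borel"
    and fin: "(\<integral>\<^sup>+w. P w \<partial>lborel) < \<infinity>"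
    and z: "norm z < 1"
  shows "ennreal (\<bar>v z\<bar> powr p) \<le> (\<Sum>i. ennreal (path_const p K * (3 / 2) ^ i) *
    (\<integral>\<^sup>+w. indicator (shadow (2 ^ i)) (z, w) * (ennreal (1 / (1 - norm w)\<^sup>2) * P w) \<partial>lborel))"
proof (cases "z = 0")
  \<comment> \<open>Separate because \<open>sgn 0 = 0\<close> is not a unit direction.\<close>
  case True
  then show ?thesis using v0 by simp
next
  case False
  define d where "d = 1 - norm z"
  have d: "0 < d" using z by (simp add: d_def)
  define C1 where "C1 = K powr p * deriv_const p * 2 powr (p + 2)"
  define S where "S = (1 / (1 - (3 / 2) powr (- 1 / p))) powr p"
  have C1: "0 \<le> C1" and S: "0 \<le> S" by (simp_all add: C1_def S_def deriv_const_nonneg)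
  \<comment> \<open>The factors come from \<open>sum_powr_le\<close> with
    \<open>\<sigma> = 3 / 2\<close>, from the change of weight, and from
    \<open>radial_step_bound\<close>.\<close>
  have const: "path_const p K = S * 9 * C1" by (simp add: path_const_def C1_def S_def)
  define X where "X i = (\<integral>\<^sup>+w. indicator (shadow (2 ^ i)) (z, w) * (ennreal (1 / (1 - norm w)\<^sup>2) * P w) \<partial>lborel)"
    for i :: nat
  define a where "a i = \<bar>v ((1 - 2 ^ i * d) *\<^sub>R sgn z) - v ((1 - min 1 (2 ^ Suc i * d)) *\<^sub>R sgn z)\<bar>" for i
  obtain m where m: "2 ^ m * d \<le> 1" "\<bar>v z\<bar> \<le> (\<Sum>i\<le>m. a i)"
    using radial_chain[where v = v and z = z, OF z v0] unfolding a_def d_def by blast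
  have sec: "(\<lambda>w. indicator (shadow q) (z, w) * P w) \<in> borel_measurable borel" for q
    by measurable
  have step: "ennreal (a i powr p) \<le> ennreal (9 * C1) * X i" if i: "i \<le> m" for i
  proof -
    define r where "r = 2 ^ i * d"
    have "(2::real) ^ i \<le> 2 ^ m" using i by (intro power_increasing) auto
    then have "2 ^ i * d \<le> 2 ^ m * d" using d by (intro mult_right_mono) auto
    also note m(1)
    finally have r: "0 < r" "r \<le> 1" using d by (simp_all add: r_def)
    define J where "J = (\<integral>\<^sup>+w. indicator (shadow (2 ^ i)) (z, w) * P w \<partial>lborel)"
    have "J \<le> (\<integral>\<^sup>+w. P w \<partial>lborel)"
      unfolding J_def by (intro nn_integral_mono) (auto simp: indicator_def)
    \<comment> \<open>\<open>radial_step_bound\<close> takes a real bound for the integral, so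
      finiteness of \<open>J\<close> is used here.\<close>
    then have J: "J = ennreal (enn2real J)" using fin
      by (metis ennreal_enn2real infinity_ennreal_def le_less_trans)
    have "(\<integral>\<^sup>+w. indicator {w. norm w < 1 \<and> 1 - norm w < 3 * r \<and> r \<le> 2 * (1 - norm w) \<and>
        norm (sgn z - sgn w) \<le> 7 * (1 - norm w)} w * ennreal (\<bar>Re (F w)\<bar> powr p) \<partial>lborel) = J"
      unfolding J_def using z by (intro nn_integral_cong) (auto simp: indicator_def P shadow_def r_def d_def)
    then have "\<bar>v ((1 - r) *\<^sub>R sgn z) - v ((1 - min 1 (2 * r)) *\<^sub>R sgn z)\<bar> powr p
        \<le> K powr p * deriv_const p * 2 powr (p + 2) * enn2real J / r\<^sup>2"
      using r J False
      by (intro radial_step_bound[OF hol v v' K p]) (auto simp: norm_sgn)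
    then have "a i powr p \<le> C1 * (enn2real J / r\<^sup>2)"
      by (simp add: a_def r_def C1_def mult.assoc)
    then have "ennreal (a i powr p) \<le> ennreal (C1 * (1 / r\<^sup>2)) * J"
      using C1 by (subst J) (simp add: ennreal_leI flip: ennreal_mult)
    also have "\<dots> = (\<integral>\<^sup>+w. ennreal (C1 * (1 / r\<^sup>2)) * (indicator (shadow (2 ^ i)) (z, w) * P w) \<partial>lborel)"
      unfolding J_def using sec[of "2 ^ i"] by (simp add: nn_integral_cmult)
    also have "\<dots> \<le> (\<integral>\<^sup>+w. ennreal (9 * C1) *
        (indicator (shadow (2 ^ i)) (z, w) * (ennreal (1 / (1 - norm w)\<^sup>2) * P w)) \<partial>lborel)"
    proof (rule nn_integral_mono)
      fix w
      show "ennreal (C1 * (1 / r\<^sup>2)) * (indicator (shadow (2 ^ i)) (z, w) * P w)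
          \<le> ennreal (9 * C1) * (indicator (shadow (2 ^ i)) (z, w) * (ennreal (1 / (1 - norm w)\<^sup>2) * P w))"
      proof (cases "(z, w) \<in> shadow (2 ^ i)")
        case True
        then have w: "0 < 1 - norm w" "1 - norm w < 3 * r" by (auto simp: shadow_def r_def d_def)
        then have "(1 - norm w)\<^sup>2 \<le> (3 * r)\<^sup>2" by (intro power_mono) auto
        then have "1 / r\<^sup>2 \<le> 9 * (1 / (1 - norm w)\<^sup>2)"
          using w r by (simp add: field_simps)
        from mult_left_mono[OF this C1] have "C1 * (1 / r\<^sup>2) \<le> 9 * C1 * (1 / (1 - norm w)\<^sup>2)"
          by (simp only: mult_ac)
        then have "ennreal (C1 * (1 / r\<^sup>2)) \<le> ennreal (9 * C1) * ennreal (1 / (1 - norm w)\<^sup>2)"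
          using C1 by (subst ennreal_mult[symmetric]) (auto intro: ennreal_leI)
        then have "ennreal (C1 * (1 / r\<^sup>2)) * P w \<le> ennreal (9 * C1) * ennreal (1 / (1 - norm w)\<^sup>2) * P w"
          by (rule mult_right_mono) simp
        then show ?thesis using True by (simp add: mult.assoc)
      qed simp
    qed
    also have "\<dots> = ennreal (9 * C1) * X i"
      unfolding X_def by (rule nn_integral_cmult) measurable
    finally show ?thesis .
  qed
  have "\<bar>v z\<bar> powr p \<le> (\<Sum>i\<le>m. a i) powr p"
    using m p by (intro powr_mono2) auto
  also have "\<dots> \<le> S * (\<Sum>i\<le>m. (3 / 2) ^ i * a i powr p)"
    unfolding S_def using p by (intro sum_powr_le) (auto simp: a_def)
  finally have "ennreal (\<bar>v z\<bar> powr p) \<le> ennreal (S * (\<Sum>i\<le>m. (3 / 2) ^ i * a i powr p))"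
    by (rule ennreal_leI)
  also have "\<dots> = (\<Sum>i\<le>m. ennreal (S * (3 / 2) ^ i) * ennreal (a i powr p))"
    using S by (simp add: sum_distrib_left mult.assoc flip: ennreal_mult sum_ennreal)
  also have "\<dots> \<le> (\<Sum>i\<le>m. ennreal (S * (3 / 2) ^ i) * (ennreal (9 * C1) * X i))"
    by (intro sum_mono mult_left_mono step) auto
  also have "\<dots> = (\<Sum>i\<le>m. ennreal (path_const p K * (3 / 2) ^ i) * X i)"
  proof (intro sum.cong refl)
    fix i
    have "ennreal (S * (3 / 2) ^ i) * ennreal (9 * C1) = ennreal (path_const p K * (3 / 2) ^ i)"
      using S C1 by (subst ennreal_mult[symmetric]) (auto simp: const mult_ac)
    then show "ennreal (S * (3 / 2) ^ i) * (ennreal (9 * C1) * X i) = ennreal (path_const p K * (3 / 2) ^ i) * X i"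
      by (simp only: flip: mult.assoc)
  qed
  also have "\<dots> \<le> (\<Sum>i. ennreal (path_const p K * (3 / 2) ^ i) * X i)"
    by (intro sum_le_suminf) auto
  finally show ?thesis unfolding X_def .
qed

text \<open>Integrates the pointwise series term by term. The growth \<open>(3 / 2) ^ i\<close>
  meets the decay \<open>1 / 2 ^ i\<close> of the shadow areas; the series of
  \<open>(3 / 4) ^ i\<close> has sum 4, and \<open>1400 * 4 = 5600\<close>. Any
  \<open>\<sigma>\<close> strictly between 1 and 2 would give convergence.\<close>

lemma nn_integral_powr_bound:
  fixes F :: "complex \<Rightarrow> complex" and v :: "complex \<Rightarrow> real"
  assumes hol: "F holomorphic_on ball 0 1"
    and v: "\<And>z. z \<in> ball 0 1 \<Longrightarrow> (v has_derivative v' z) (at z)"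
    and v': "\<And>z h. z \<in> ball 0 1 \<Longrightarrow> \<bar>v' z h\<bar> \<le> K * norm (deriv F z) * norm h"
    and K: "0 \<le> K" and p: "0 < p" and v0: "v 0 = 0"
    and fin: "(\<integral>\<^sup>+w. indicator (ball 0 1) w * ennreal (\<bar>Re (F w)\<bar> powr p) \<partial>lborel) < \<infinity>"
  shows "(\<integral>\<^sup>+z. indicator (ball 0 1) z * ennreal (\<bar>v z\<bar> powr p) \<partial>lborel)
    \<le> ennreal (path_const p K * 5600 * pi) *
      (\<integral>\<^sup>+w. indicator (ball 0 1) w * ennreal (\<bar>Re (F w)\<bar> powr p) \<partial>lborel)"
proof -
  define P where "P w = indicator (ball 0 1) w * ennreal (\<bar>Re (F w)\<bar> powr p)" for w
  have "continuous_on (ball 0 1) (\<lambda>w. Re (F w))"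
    using holomorphic_on_imp_continuous_on[OF hol] by (intro continuous_intros)
  from measurable_indicator_powr[OF this open_ball p]
  have P[measurable]: "P \<in> borel_measurable borel"
    by (simp only: P_def[abs_def])
  define X where "X i z = (\<integral>\<^sup>+w. indicator (shadow (2 ^ i)) (z, w) * (ennreal (1 / (1 - norm w)\<^sup>2) * P w) \<partial>lborel)"
    for i :: nat and z
  have X[measurable]: "X i \<in> borel_measurable borel" for i
    unfolding X_def by measurable
  have "(\<integral>\<^sup>+z. indicator (ball 0 1) z * ennreal (\<bar>v z\<bar> powr p) \<partial>lborel)
      \<le> (\<integral>\<^sup>+z. (\<Sum>i. ennreal (path_const p K * (3 / 2) ^ i) * X i z) \<partial>lborel)"
  proof (rule nn_integral_mono)
    fix z
    show "indicator (ball 0 1) z * ennreal (\<bar>v z\<bar> powr p)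
        \<le> (\<Sum>i. ennreal (path_const p K * (3 / 2) ^ i) * X i z)"
      using pointwise_shadow_bound[OF hol v v' K p v0 P_def P, of z] fin
      by (cases "norm z < 1") (auto simp: X_def P_def)
  qed
  also have "\<dots> = (\<Sum>i. ennreal (path_const p K * (3 / 2) ^ i) * (\<integral>\<^sup>+z. X i z \<partial>lborel))"
    by (simp add: nn_integral_suminf nn_integral_cmult)
  also have "\<dots> \<le> (\<Sum>i. ennreal (path_const p K * (3 / 2) ^ i) * (ennreal (1400 * pi / 2 ^ i) * (\<integral>\<^sup>+w. P w \<partial>lborel)))"
  proof (intro suminf_le mult_left_mono)
    fix i
    show "(\<integral>\<^sup>+z. X i z \<partial>lborel) \<le> ennreal (1400 * pi / 2 ^ i) * (\<integral>\<^sup>+w. P w \<partial>lborel)"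
      unfolding X_def by (rule nn_integral_shadow[OF P]) (auto simp: P_def)
  qed auto
  also have "\<dots> = (\<Sum>i. ennreal (path_const p K * 1400 * pi * (3 / 4) ^ i) * (\<integral>\<^sup>+w. P w \<partial>lborel))"
  proof (intro suminf_cong)
    fix i :: nat
    have "(3 / 2) ^ i / 2 ^ i = (3 / 4 :: real) ^ i" by (simp flip: power_divide)
    then have "path_const p K * (3 / 2) ^ i * (1400 * pi / 2 ^ i) = path_const p K * 1400 * pi * (3 / 4) ^ i"
      by (simp add: field_simps)
    moreover have "ennreal (path_const p K * (3 / 2) ^ i) * ennreal (1400 * pi / 2 ^ i)
        = ennreal (path_const p K * (3 / 2) ^ i * (1400 * pi / 2 ^ i))"
      using path_const_nonneg[of p K] by (subst ennreal_mult) auto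
    ultimately show "ennreal (path_const p K * (3 / 2) ^ i) * (ennreal (1400 * pi / 2 ^ i) * (\<integral>\<^sup>+w. P w \<partial>lborel))
        = ennreal (path_const p K * 1400 * pi * (3 / 4) ^ i) * (\<integral>\<^sup>+w. P w \<partial>lborel)"
      by (simp only: flip: mult.assoc)
  qed
  also have "\<dots> = (\<Sum>i. ennreal (path_const p K * 1400 * pi * (3 / 4) ^ i)) * (\<integral>\<^sup>+w. P w \<partial>lborel)"
    by (rule ennreal_suminf_multc)
  also have "(\<Sum>i. ennreal (path_const p K * 1400 * pi * (3 / 4) ^ i)) = ennreal (path_const p K * 5600 * pi)"
  proof (rule suminf_ennreal_eq)
    have "(\<lambda>i. path_const p K * 1400 * pi * (3 / 4) ^ i) sums (path_const p K * 1400 * pi * (1 / (1 - 3 / 4)))"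
      by (intro sums_mult geometric_sums) auto
    then show "(\<lambda>i. path_const p K * 1400 * pi * (3 / 4) ^ i) sums (path_const p K * 5600 * pi)"
      by (simp add: mult_ac)
  qed (use path_const_nonneg[of p K] in auto)
  finally show ?thesis unfolding P_def .
qed


subsection \<open>Harmonic functions as real parts\<close>

text \<open>The quotient is symmetric in \<open>a\<close> and \<open>b\<close>, which gives the equality of the mixed partials.\<close>

lemma second_difference_quotient:
  fixes f :: "complex \<Rightarrow> real"
  assumes S: "open S" "z \<in> S"
    and f: "\<And>w. w \<in> S \<Longrightarrow> f differentiable (at w)"
    and G: "\<And>w. G w = frechet_derivative f (at w) a" and Gd: "G differentiable (at z)"
  shows "((\<lambda>t. (f (z + t *\<^sub>R a + t *\<^sub>R b) - f (z + t *\<^sub>R a) - f (z + t *\<^sub>R b) + f z) / t\<^sup>2)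
    \<longlongrightarrow> frechet_derivative G (at z) b) (at_right 0)"
proof (rule tendstoI)
  fix e :: real assume e: "0 < e"
  define A where "A = frechet_derivative G (at z)"
  \<comment> \<open>The two points compared below have displacements \<open>h\<close> and
    \<open>k\<close> from \<open>z\<close> with \<open>norm h + norm k < t * M\<close>, so an error
    rate \<open>e / M\<close> in the expansion of \<open>G\<close> costs less than
    \<open>e * t\<close>. The summand 1 keeps \<open>M\<close> positive and the inequality
    strict.\<close>
  define M where "M = 2 * norm a + norm b + 1"
  have M: "0 < M" "2 * norm a + norm b < M" by (simp_all add: M_def add_nonneg_pos)
  have A: "(G has_derivative A) (at z)" using Gd by (simp add: A_def frechet_derivative_works)
  interpret A: bounded_linear A using A by (rule has_derivative_bounded_linear)
  have "0 < e / M" using e M by simp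
  with A obtain d where d: "0 < d" "\<And>w. norm (w - z) < d \<Longrightarrow> norm (G w - G z - A (w - z)) \<le> e / M * norm (w - z)"
    unfolding has_derivative_at_alt by blast
  obtain d' where d': "0 < d'" "ball z d' \<subseteq> S" using S openE by blast
  define t0 where "t0 = min d d' / M"
  have t0: "0 < t0" using d d' M by (simp add: t0_def)
  show "\<forall>\<^sub>F t in at_right 0. dist ((f (z + t *\<^sub>R a + t *\<^sub>R b) - f (z + t *\<^sub>R a) - f (z + t *\<^sub>R b) + f z) / t\<^sup>2)
      (frechet_derivative G (at z) b) < e"
    unfolding eventually_at_right_field
  proof (intro exI[of _ t0] conjI t0 allI impI)
    fix t :: real assume t: "0 < t" "t < t0"
    have tM: "t * M < min d d'" using t M by (simp add: t0_def field_simps)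
    have small: "norm (s *\<^sub>R a + c *\<^sub>R b) < min d d'" if "0 \<le> s" "s \<le> t" "0 \<le> c" "c \<le> t" for s c
    proof -
      have "norm (s *\<^sub>R a + c *\<^sub>R b) \<le> s * norm a + c * norm b"
        using that by (intro norm_triangle_le) simp
      also have "\<dots> \<le> t * norm a + t * norm b"
        using that by (intro add_mono mult_right_mono) auto
      also have "\<dots> \<le> t * M" using t by (simp add: M_def algebra_simps)
      finally show ?thesis using tM by simp
    qed
    have inS: "z + (s *\<^sub>R a + c *\<^sub>R b) \<in> S" if "0 \<le> s" "s \<le> t" "0 \<le> c" "c \<le> t" for s c
    proof -
      have "dist z (z + (s *\<^sub>R a + c *\<^sub>R b)) = norm (s *\<^sub>R a + c *\<^sub>R b)"
        by (metis add_diff_cancel_left' dist_commute dist_norm)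
      then show ?thesis
        using small[OF that] d'(2) by (intro subsetD[OF d'(2)]) (simp only: mem_ball)
    qed
    \<comment> \<open>The second difference of \<open>f\<close> is \<open>g t - g 0\<close>. The
      mean value theorem in direction \<open>a\<close> turns it into a difference of two values of
      \<open>G\<close>, to which the expansion of \<open>G\<close> at the single point
      \<open>z\<close> applies.\<close>
    define g where "g s = f (z + (s *\<^sub>R a + t *\<^sub>R b)) - f (z + (s *\<^sub>R a + 0 *\<^sub>R b))" for s
    have der: "((\<lambda>s. f (z + (s *\<^sub>R a + c *\<^sub>R b))) has_real_derivative G (z + (s *\<^sub>R a + c *\<^sub>R b))) (at s)"
      if s: "0 \<le> s" "s \<le> t" "0 \<le> c" "c \<le> t" for s c
    proof -
      let ?w = "z + (s *\<^sub>R a + c *\<^sub>R b)"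
      have fd: "(f has_derivative frechet_derivative f (at ?w)) (at ?w)"
        using f[OF inS[OF s]] by (simp add: frechet_derivative_works)
      have "((\<lambda>s. f (z + (s *\<^sub>R a + c *\<^sub>R b))) has_derivative (\<lambda>h. frechet_derivative f (at ?w) (h *\<^sub>R a))) (at s)"
      proof (rule has_derivative_compose[where f = "\<lambda>s. z + (s *\<^sub>R a + c *\<^sub>R b)" and g = f])
        show "((\<lambda>s. z + (s *\<^sub>R a + c *\<^sub>R b)) has_derivative (\<lambda>h. h *\<^sub>R a)) (at s)"
          by (auto intro!: derivative_eq_intros)
      qed (rule fd)
      moreover have "frechet_derivative f (at ?w) (h *\<^sub>R a) = G ?w * h" for h
        using linear_scale[OF has_derivative_linear[OF fd]] by (simp add: G)
      ultimately show ?thesis by (simp add: has_field_derivative_def)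
    qed
    have "\<exists>s. 0 < s \<and> s < t \<and> g t - g 0 = (t - 0) * (G (z + (s *\<^sub>R a + t *\<^sub>R b)) - G (z + (s *\<^sub>R a + 0 *\<^sub>R b)))"
      unfolding g_def using t by (intro MVT2 DERIV_diff der) auto
    then obtain s where s: "0 < s" "s < t"
      and gs: "g t - g 0 = t * (G (z + (s *\<^sub>R a + t *\<^sub>R b)) - G (z + (s *\<^sub>R a + 0 *\<^sub>R b)))" by auto
    define h k where "h = s *\<^sub>R a + t *\<^sub>R b" and "k = s *\<^sub>R a"
    have hk: "norm h < d" "norm k < d"
      using small[of s t] small[of s 0] s by (auto simp: h_def k_def)
    have 1: "\<bar>G (z + h) - G z - A h\<bar> \<le> e / M * norm h" "\<bar>G (z + k) - G z - A k\<bar> \<le> e / M * norm k"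
      using d(2)[of "z + h"] d(2)[of "z + k"] hk by auto
    have Ahk: "A h - A k = t * A b" by (simp add: h_def k_def A.add A.scaleR)
    have "norm h + norm k < t * M"
    proof -
      have "norm h \<le> s * norm a + t * norm b"
        unfolding h_def using s t by (intro norm_triangle_le) simp
      moreover have "norm k = s * norm a" using s by (simp add: k_def)
      moreover have "s * norm a \<le> t * norm a" using s by (intro mult_right_mono) auto
      ultimately have "norm h + norm k \<le> t * (2 * norm a + norm b)" by (simp add: algebra_simps)
      also have "\<dots> < t * M" using t M by simp
      finally show ?thesis .
    qed
    then have "e / M * (norm h + norm k) < e / M * (t * M)"
      using e M by (intro mult_strict_left_mono) auto
    then have 2: "e / M * norm h + e / M * norm k < e * t"
      using M by (simp add: distrib_left)
    have "\<bar>G (z + h) - G (z + k) - t * A b\<bar> < e * t"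
      using 1 2 Ahk by linarith
    then have "\<bar>t * (G (z + h) - G (z + k)) / t\<^sup>2 - A b\<bar> < e"
    proof -
      have "t * (G (z + h) - G (z + k)) / t\<^sup>2 - A b = (G (z + h) - G (z + k) - t * A b) / t"
        using t by (simp add: field_simps power2_eq_square)
      then show ?thesis
        using t \<open>\<bar>G (z + h) - G (z + k) - t * A b\<bar> < e * t\<close> by (simp add: abs_divide divide_less_eq)
    qed
    moreover have "f (z + t *\<^sub>R a + t *\<^sub>R b) - f (z + t *\<^sub>R a) - f (z + t *\<^sub>R b) + f z = t * (G (z + h) - G (z + k))"
      using gs by (simp add: g_def h_def k_def add.assoc)
    ultimately show "dist ((f (z + t *\<^sub>R a + t *\<^sub>R b) - f (z + t *\<^sub>R a) - f (z + t *\<^sub>R b) + f z) / t\<^sup>2)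
        (frechet_derivative G (at z) b) < e"
      by (simp add: dist_real_def A_def)
  qed
qed

lemma mixed_partials_eq:
  fixes f :: "complex \<Rightarrow> real"
  assumes S: "open S" "z \<in> S" and f: "C2_on S f"
  shows "partial_x (partial_y f) z = partial_y (partial_x f) z"
proof -
  have d: "f differentiable (at w)" "partial_x f differentiable (at w)" "partial_y f differentiable (at w)"
    if "w \<in> S" for w
    using f that by (auto simp: C2_on_def C1_on_def)
  define q where "q t = (f (z + t *\<^sub>R 1 + t *\<^sub>R \<i>) - f (z + t *\<^sub>R 1) - f (z + t *\<^sub>R \<i>) + f z) / t\<^sup>2" for t :: real
  have "(q \<longlongrightarrow> partial_y (partial_x f) z) (at_right 0)"
    unfolding q_def partial_y_def[of "partial_x f"]
    by (rule second_difference_quotient[OF S d(1)]) (auto simp: partial_x_def d S)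
  moreover have "(q \<longlongrightarrow> partial_x (partial_y f) z) (at_right 0)"
  proof -
    have "q = (\<lambda>t. (f (z + t *\<^sub>R \<i> + t *\<^sub>R 1) - f (z + t *\<^sub>R \<i>) - f (z + t *\<^sub>R 1) + f z) / t\<^sup>2)"
      by (simp add: q_def fun_eq_iff algebra_simps)
    then show ?thesis
      unfolding partial_x_def[of "partial_y f"]
      using second_difference_quotient[OF S d(1), of "partial_y f" \<i> 1] by (simp add: partial_y_def d S)
  qed
  ultimately show ?thesis
    using tendsto_unique trivial_limit_at_right_real by blast
qed

lemma has_derivative_partials:
  fixes f :: "complex \<Rightarrow> 'a::real_normed_vector"
  assumes "f differentiable (at z)"
  shows "(f has_derivative (\<lambda>h. Re h *\<^sub>R partial_x f z + Im h *\<^sub>R partial_y f z)) (at z)"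
proof -
  have fd: "(f has_derivative frechet_derivative f (at z)) (at z)"
    using assms by (simp add: frechet_derivative_works)
  interpret bounded_linear "frechet_derivative f (at z)"
    using fd by (rule has_derivative_bounded_linear)
  have "frechet_derivative f (at z) h = Re h *\<^sub>R partial_x f z + Im h *\<^sub>R partial_y f z" for h
  proof -
    have "h = Re h *\<^sub>R 1 + Im h *\<^sub>R \<i>" by (simp add: complex_eq_iff)
    then have "frechet_derivative f (at z) h = frechet_derivative f (at z) (Re h *\<^sub>R 1 + Im h *\<^sub>R \<i>)" by simp
    also have "\<dots> = Re h *\<^sub>R partial_x f z + Im h *\<^sub>R partial_y f z"
      by (simp only: add scaleR partial_x_def partial_y_def)
    finally show ?thesis .
  qed
  then have "frechet_derivative f (at z) = (\<lambda>h. Re h *\<^sub>R partial_x f z + Im h *\<^sub>R partial_y f z)" by blast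
  with fd show ?thesis by simp
qed

lemma partials_unique:
  assumes "(f has_derivative f') (at z)"
  shows "partial_x f z = f' 1" "partial_y f z = f' \<i>"
  using frechet_derivative_at[OF assms] by (simp_all add: partial_x_def partial_y_def)

text \<open>Harmonicity and equality of the mixed partials are the Cauchy-Riemann equations for
  \<open>\<phi>\<close>. A primitive of \<open>\<phi>\<close> has a real part with the same gradient
  as \<open>u\<close>, so it differs from \<open>u\<close> by a constant. Convexity serves both for
  the primitive and for the constancy.\<close>

lemma harmonic_imp_Re_holomorphic:
  fixes u :: "complex \<Rightarrow> real"
  assumes u: "harmonic_on S u" and S: "open S" "convex S"
  obtains F where "F holomorphic_on S" "\<And>z. z \<in> S \<Longrightarrow> Re (F z) = u z"
    "\<And>z. z \<in> S \<Longrightarrow> deriv F z = of_real (partial_x u z) - \<i> * of_real (partial_y u z)"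
proof (cases "S = {}")
  case True
  then show ?thesis using that[of "\<lambda>_. 0"] by simp
next
  case False
  then obtain c where c: "c \<in> S" by auto
  have C2: "C2_on S u" using u by (simp add: harmonic_on_def)
  define \<phi> where "\<phi> z = of_real (partial_x u z) - \<i> * of_real (partial_y u z)" for z
  have d: "u differentiable (at w)" "partial_x u differentiable (at w)" "partial_y u differentiable (at w)"
    if "w \<in> S" for w
    using C2 that by (auto simp: C2_on_def C1_on_def)
  have "\<phi> holomorphic_on S"
  proof (rule holomorphic_onI)
    fix z assume z: "z \<in> S"
    define p q where "p = partial_x (partial_x u) z" and "q = partial_y (partial_x u) z"
    have q: "partial_x (partial_y u) z = q" using mixed_partials_eq[OF S(1) z C2] by (simp add: q_def)
    have p: "partial_y (partial_y u) z = - p" using u z by (simp add: harmonic_on_def p_def add_eq_0_iff)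
    have "(\<phi> has_derivative (\<lambda>h. of_real (Re h *\<^sub>R p + Im h *\<^sub>R q) - \<i> * of_real (Re h *\<^sub>R q + Im h *\<^sub>R (- p)))) (at z)"
      unfolding \<phi>_def
      using has_derivative_partials[OF d(2)[OF z]] has_derivative_partials[OF d(3)[OF z]]
      by (intro has_derivative_diff has_derivative_mult_right has_derivative_of_real)
         (simp_all add: p q p_def q_def)
    \<comment> \<open>The real derivative of \<open>\<phi>\<close> is multiplication by a complex
      number, which is complex differentiability.\<close>
    moreover have "(\<lambda>h. of_real (Re h *\<^sub>R p + Im h *\<^sub>R q) - \<i> * of_real (Re h *\<^sub>R q + Im h *\<^sub>R (- p)))
        = (*) (of_real p - \<i> * of_real q)"
      by (auto simp: fun_eq_iff complex_eq_iff algebra_simps)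
    ultimately have "(\<phi> has_field_derivative (of_real p - \<i> * of_real q)) (at z)"
      by (simp add: has_field_derivative_def)
    then show "\<phi> field_differentiable at z within S"
      using field_differentiable_at_within field_differentiable_def by blast
  qed
  then obtain g where g: "\<And>z. z \<in> S \<Longrightarrow> (g has_field_derivative \<phi> z) (at z within S)"
    using holomorphic_convex_primitive'[OF S(2,1)] by blast
  then have g': "(g has_field_derivative \<phi> z) (at z)" if "z \<in> S" for z
    using that S(1) by (metis at_within_open)
  have "(\<lambda>z. Re (g z) - u z) constant_on S"
  proof -
    have "((\<lambda>z. Re (g z) - u z) has_derivative (\<lambda>h. 0)) (at z within S)" if z: "z \<in> S" for z
    proof -
      have "((\<lambda>z. Re (g z) - u z) has_derivative
          (\<lambda>h. Re (\<phi> z * h) - (Re h *\<^sub>R partial_x u z + Im h *\<^sub>R partial_y u z))) (at z)"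
        using g'[OF z] by (intro has_derivative_diff has_derivative_Re has_derivative_partials d z)
          (simp add: has_field_derivative_def)
      moreover have "Re (\<phi> z * h) - (Re h *\<^sub>R partial_x u z + Im h *\<^sub>R partial_y u z) = 0" for h
        by (simp add: \<phi>_def mult.commute)
      ultimately show ?thesis by (simp add: has_derivative_at_withinI)
    qed
    then show ?thesis unfolding constant_on_def using has_derivative_zero_constant[OF S(2)] by blast
  qed
  then obtain k where k: "\<And>z. z \<in> S \<Longrightarrow> Re (g z) - u z = k" unfolding constant_on_def by blast
  define F where "F z = g z - of_real k" for z
  have F: "(F has_field_derivative \<phi> z) (at z)" if "z \<in> S" for z
    unfolding F_def using g'[OF that] by (auto intro!: derivative_eq_intros)
  show ?thesis
  proof (rule that[of F])
    show "F holomorphic_on S"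
      using F S(1) by (auto simp: holomorphic_on_open)
    show "Re (F z) = u z" if "z \<in> S" for z using k[OF that] by (simp add: F_def)
    show "deriv F z = of_real (partial_x u z) - \<i> * of_real (partial_y u z)" if "z \<in> S" for z
      using DERIV_imp_deriv[OF F[OF that]] by (simp add: \<phi>_def)
  qed
qed

text \<open>With \<open>a\<close>, \<open>b\<close> the Wirtinger derivatives,
  \<open>a + cnj b\<close> carries the gradient of the real part and \<open>a - cnj b\<close> that
  of the imaginary part. Hence the latter is at most
  \<open>norm a + norm b \<le> K * (norm a - norm b)\<close>, and \<open>norm a - norm b\<close> is
  at most the former.\<close>

lemma quasiregular_gradient_bound:
  assumes f: "harmonic_quasiregular K f" and z: "z \<in> unit_disk" and K: "1 \<le> K"
  shows "\<bar>Re h *\<^sub>R partial_x (\<lambda>z. Im (f z)) z + Im h *\<^sub>R partial_y (\<lambda>z. Im (f z)) z\<bar>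
    \<le> K * norm (complex_of_real (partial_x (\<lambda>z. Re (f z)) z) - \<i> * of_real (partial_y (\<lambda>z. Re (f z)) z)) * norm h"
proof -
  define ux uy vx vy where "ux = partial_x (\<lambda>z. Re (f z)) z" and "uy = partial_y (\<lambda>z. Re (f z)) z"
    and "vx = partial_x (\<lambda>z. Im (f z)) z" and "vy = partial_y (\<lambda>z. Im (f z)) z"
  have sp: "sense_preserving_harmonic f" and dil: "dilatation f z \<le> K"
    using f z by (auto simp: harmonic_quasiregular_def)
  have du: "(\<lambda>z. Re (f z)) differentiable (at z)" and dv: "(\<lambda>z. Im (f z)) differentiable (at z)"
    using sp z by (auto simp: sense_preserving_harmonic_def harmonic_on_def C2_on_def C1_on_def)
  have "((\<lambda>z. of_real (Re (f z)) + \<i> * of_real (Im (f z))) has_derivative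
      (\<lambda>h. of_real (Re h *\<^sub>R ux + Im h *\<^sub>R uy) + \<i> * of_real (Re h *\<^sub>R vx + Im h *\<^sub>R vy))) (at z)"
    unfolding ux_def uy_def vx_def vy_def
    by (intro has_derivative_add has_derivative_mult_right has_derivative_of_real has_derivative_partials du dv)
  then have fd: "(f has_derivative
      (\<lambda>h. of_real (Re h *\<^sub>R ux + Im h *\<^sub>R uy) + \<i> * of_real (Re h *\<^sub>R vx + Im h *\<^sub>R vy))) (at z)"
    by (simp flip: complex_eq)
  have fx: "partial_x f z = of_real ux + \<i> * of_real vx" and fy: "partial_y f z = of_real uy + \<i> * of_real vy"
    using partials_unique[OF fd] by simp_all
  define a b where "a = wirtinger_z f z" and "b = wirtinger_zbar f z"
  have ab: "a + cnj b = of_real ux - \<i> * of_real uy" "a - cnj b = \<i> * (of_real vx - \<i> * of_real vy)"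
    by (simp_all add: a_def b_def wirtinger_z_def wirtinger_zbar_def fx fy complex_eq_iff field_simps)
  obtain \<omega> where \<omega>: "norm (\<omega> z) < 1" "cnj b = \<omega> z * a"
    using sp z unfolding sense_preserving_harmonic_def a_def b_def by blast
  have "norm a + norm b \<le> K * (norm a - norm b)"
  proof (cases "a = 0")
    \<comment> \<open>At a critical point the dilatation is 0 / 0 = 0 and says nothing; here
      \<open>b = 0\<close> follows from the equation for \<open>\<omega>\<close>. Elsewhere
      \<open>norm (\<omega> z) < 1\<close> makes the denominator positive.\<close>
    case True
    then show ?thesis using \<omega>(2) by simp
  next
    case False
    have "norm b = norm (\<omega> z) * norm a" using arg_cong[OF \<omega>(2), of norm] by (simp add: norm_mult)
    then have "norm b < norm a" using \<omega>(1) False by simp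
    then show ?thesis using dil unfolding dilatation_def a_def[symmetric] b_def[symmetric]
      by (simp add: divide_le_eq)
  qed
  moreover have "norm (a - cnj b) \<le> norm a + norm b" using norm_triangle_ineq4[of a "cnj b"] by simp
  moreover have "K * (norm a - norm b) \<le> K * norm (a + cnj b)"
    using K norm_diff_ineq[of a "cnj b"] by (intro mult_left_mono) auto
  ultimately have grad: "norm (of_real vx - \<i> * of_real vy) \<le> K * norm (complex_of_real ux - \<i> * of_real uy)"
    unfolding ab by (simp add: norm_mult)
  have "\<bar>Re h *\<^sub>R vx + Im h *\<^sub>R vy\<bar> = \<bar>Re ((of_real vx - \<i> * of_real vy) * h)\<bar>"
    by (simp add: mult.commute)
  also have "\<dots> \<le> norm (of_real vx - \<i> * of_real vy) * norm h"
    using abs_Re_le_cmod norm_mult by metis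
  also have "\<dots> \<le> K * norm (complex_of_real ux - \<i> * of_real uy) * norm h"
    using grad by (intro mult_right_mono) auto
  finally show ?thesis unfolding ux_def uy_def vx_def vy_def .
qed

subsection \<open>Bergman norms\<close>

text \<open>Brings the factor \<open>1 / pi\<close> within reach of the integral rules for
  \<open>density\<close>.\<close>

lemma disk_area_eq_density:
  "disk_area = density (restrict_space lborel unit_disk) (\<lambda>_. ennreal (1 / pi))"
  unfolding disk_area_def by (rule measure_eqI) (simp_all add: emeasure_density_const)

lemma nn_integral_disk_area:
  assumes "g \<in> borel_measurable disk_area"
  shows "(\<integral>\<^sup>+z. g z \<partial>disk_area) = ennreal (1 / pi) * (\<integral>\<^sup>+z. indicator (ball 0 1) z * g z \<partial>lborel)"
proof -
  have "g \<in> borel_measurable (restrict_space lborel unit_disk)"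
    using assms by (simp add: disk_area_eq_density)
  then show ?thesis
    by (simp add: disk_area_eq_density nn_integral_density nn_integral_cmult)
       (simp add: nn_integral_restrict_space mult.commute)
qed

lemma borel_measurable_disk_area:
  fixes g :: "complex \<Rightarrow> 'a::topological_space"
  assumes "continuous_on unit_disk g"
  shows "g \<in> borel_measurable disk_area"
proof -
  have "g \<in> borel_measurable (restrict_space borel unit_disk)"
    by (rule borel_measurable_continuous_on_restrict[OF assms])
  also have "borel_measurable (restrict_space borel unit_disk) = (borel_measurable disk_area :: (complex \<Rightarrow> 'a) set)"
    by (intro measurable_cong_sets) (simp_all add: disk_area_def sets_restrict_space)
  finally show ?thesis .
qed


lemma integrable_disk_area_iff:
  fixes g :: "complex \<Rightarrow> real"
  assumes g: "continuous_on unit_disk g" "\<And>z. 0 \<le> g z"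
  shows "integrable disk_area g \<longleftrightarrow> (\<integral>\<^sup>+z. indicator (ball 0 1) z * ennreal (g z) \<partial>lborel) < \<infinity>"
proof -
  have m: "g \<in> borel_measurable disk_area" by (rule borel_measurable_disk_area[OF g(1)])
  then have "(\<lambda>z. ennreal (g z)) \<in> borel_measurable disk_area" by measurable
  with m show ?thesis
    by (auto simp: integrable_iff_bounded g(2) nn_integral_disk_area ennreal_mult_less_top)
qed

lemma harmonic_on_imp_continuous_on: "harmonic_on S f \<Longrightarrow> continuous_on S f"
  unfolding harmonic_on_def C2_on_def C1_on_def
  by (meson continuous_at_imp_continuous_on differentiable_imp_continuous_within)

text \<open>Only the real part and \<open>norm (deriv F z)\<close> of the holomorphic
  \<open>F\<close> enter; \<open>Im (f z)\<close> is in general not its imaginary part and is tied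
  to \<open>F\<close> by the gradient bound alone. Subtracting \<open>Im (f 0)\<close> provides the
  zero at the origin.\<close>

lemma conjugate_powr_bound:
  assumes f: "harmonic_quasiregular K f" and K: "1 \<le> K" and p: "0 < p"
    and fin: "(\<integral>\<^sup>+w. indicator (ball 0 1) w * ennreal (\<bar>Re (f w)\<bar> powr p) \<partial>lborel) < \<infinity>"
  shows "(\<integral>\<^sup>+z. indicator (ball 0 1) z * ennreal (\<bar>Im (f z) - Im (f 0)\<bar> powr p) \<partial>lborel)
    \<le> ennreal (path_const p K * 5600 * pi) *
      (\<integral>\<^sup>+w. indicator (ball 0 1) w * ennreal (\<bar>Re (f w)\<bar> powr p) \<partial>lborel)"
proof -
  have u: "harmonic_on unit_disk (\<lambda>z. Re (f z))" and v: "harmonic_on unit_disk (\<lambda>z. Im (f z))"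
    using f by (auto simp: harmonic_quasiregular_def sense_preserving_harmonic_def)
  obtain F where F: "F holomorphic_on unit_disk" "\<And>z. z \<in> unit_disk \<Longrightarrow> Re (F z) = Re (f z)"
    "\<And>z. z \<in> unit_disk \<Longrightarrow> deriv F z = of_real (partial_x (\<lambda>z. Re (f z)) z) - \<i> * of_real (partial_y (\<lambda>z. Re (f z)) z)"
    using harmonic_imp_Re_holomorphic[OF u] by auto
  have eq: "(\<integral>\<^sup>+w. indicator (ball 0 1) w * ennreal (\<bar>Re (F w)\<bar> powr p) \<partial>lborel)
      = (\<integral>\<^sup>+w. indicator (ball 0 1) w * ennreal (\<bar>Re (f w)\<bar> powr p) \<partial>lborel)"
    using F(2) by (intro nn_integral_cong) (auto simp: indicator_def)
  define v' where "v' z h = Re h *\<^sub>R partial_x (\<lambda>z. Im (f z)) z + Im h *\<^sub>R partial_y (\<lambda>z. Im (f z)) z" for z h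
  have "(\<integral>\<^sup>+z. indicator (ball 0 1) z * ennreal (\<bar>Im (f z) - Im (f 0)\<bar> powr p) \<partial>lborel)
    \<le> ennreal (path_const p K * 5600 * pi) *
      (\<integral>\<^sup>+w. indicator (ball 0 1) w * ennreal (\<bar>Re (F w)\<bar> powr p) \<partial>lborel)"
  proof (rule nn_integral_powr_bound[OF F(1)])
    fix z :: complex assume z: "z \<in> unit_disk"
    have "((\<lambda>z. Im (f z)) has_derivative v' z) (at z)"
      unfolding v'_def using v z
      by (intro has_derivative_partials) (auto simp: harmonic_on_def C2_on_def C1_on_def)
    from has_derivative_diff[OF this has_derivative_const]
    show "((\<lambda>z. Im (f z) - Im (f 0)) has_derivative v' z) (at z)" by simp
    show "\<bar>v' z h\<bar> \<le> K * norm (deriv F z) * norm h" for h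
      unfolding v'_def F(3)[OF z] by (rule quasiregular_gradient_bound[OF f z K])
  qed (use K p fin in \<open>auto simp: eq\<close>)
  then show ?thesis by (simp only: eq)
qed

text \<open>The norm inequality requires a normalisation such as \<open>Im (f 0) = 0\<close>: adding
  an imaginary constant to \<open>f\<close> changes neither the real part nor the dilatation, but
  makes the norm of the imaginary part arbitrarily large. Membership is unaffected, since the disk
  has finite area. \<open>C\<close> is quantified before \<open>f\<close>, so it depends on
  \<open>p\<close> and \<open>K\<close> only.\<close>

theorem theorem1:
  fixes p K :: real
  assumes "0 < p" and "1 \<le> K"
  shows "\<exists>C::real. \<forall>f::complex \<Rightarrow> complex.
           harmonic_quasiregular K f \<and> (\<lambda>z. Re (f z)) \<in> harmonic_bergman p \<longrightarrow>
             (\<lambda>z. Im (f z)) \<in> harmonic_bergman p \<and>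
             (Im (f 0) = 0 \<longrightarrow>
                bergman_norm p (\<lambda>z. Im (f z)) \<le> C * bergman_norm p (\<lambda>z. Re (f z)))"
proof (intro exI allI impI)
  note p = assms(1) and K = assms(2)
  \<comment> \<open>Constant for the integrals of p-th powers; the witness for \<open>C\<close> is
    \<open>c powr (1 / p)\<close>, fixed by the final \<open>show\<close>.\<close>
  define c where "c = path_const p K * 5600 * pi"
  have c: "0 \<le> c" by (simp add: c_def path_const_nonneg)
  fix f :: "complex \<Rightarrow> complex"
  assume "harmonic_quasiregular K f \<and> (\<lambda>z. Re (f z)) \<in> harmonic_bergman p"
  then have f: "harmonic_quasiregular K f" and u: "(\<lambda>z. Re (f z)) \<in> harmonic_bergman p" by auto
  have v: "harmonic_on unit_disk (\<lambda>z. Im (f z))"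
    using f by (auto simp: harmonic_quasiregular_def sense_preserving_harmonic_def)
  have cont_powr: "continuous_on unit_disk (\<lambda>z. \<bar>g z\<bar> powr p)" if "continuous_on unit_disk g"
    for g :: "complex \<Rightarrow> real"
    using that p by (intro continuous_on_powr' continuous_intros) auto
  have cu: "continuous_on unit_disk (\<lambda>z. \<bar>Re (f z)\<bar> powr p)"
    using u by (intro cont_powr harmonic_on_imp_continuous_on) (simp add: harmonic_bergman_def)
  have cv: "continuous_on unit_disk (\<lambda>z. \<bar>Im (f z) - k\<bar> powr p)" for k
    using v by (intro cont_powr continuous_on_diff harmonic_on_imp_continuous_on continuous_on_const)
  have int_u: "integrable disk_area (\<lambda>z. \<bar>Re (f z)\<bar> powr p)"
    using u by (simp add: harmonic_bergman_def)
  then have fin: "(\<integral>\<^sup>+w. indicator (ball 0 1) w * ennreal (\<bar>Re (f w)\<bar> powr p) \<partial>lborel) < \<infinity>"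
    by (subst (asm) integrable_disk_area_iff[OF cu]) auto
  note bound = conjugate_powr_bound[OF f K p fin, folded c_def]
  have "(\<integral>\<^sup>+z. indicator (ball 0 1) z * ennreal (\<bar>Im (f z) - Im (f 0)\<bar> powr p) \<partial>lborel) < \<infinity>"
    using fin by (intro le_less_trans[OF bound]) (simp add: ennreal_mult_less_top)
  then have int_d: "integrable disk_area (\<lambda>z. \<bar>Im (f z) - Im (f 0)\<bar> powr p)"
    by (subst integrable_disk_area_iff[OF cv]) auto
  have int_c: "integrable disk_area (\<lambda>z. k)" if "0 \<le> k" for k :: real
  proof -
    have "(\<integral>\<^sup>+z. indicator (ball (0::complex) 1) z * ennreal k \<partial>lborel) = ennreal k * emeasure lborel (ball (0::complex) 1)"
      by (subst mult.commute) (simp add: nn_integral_cmult_indicator)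
    also have "\<dots> < \<infinity>"
      using emeasure_lborel_ball_finite[of "0::complex" 1] by (simp add: ennreal_mult_less_top)
    finally show ?thesis using that by (subst integrable_disk_area_iff) auto
  qed
  \<comment> \<open>Adds back the constant \<open>Im (f 0)\<close>. Bounding \<open>x + y\<close> by
    twice the maximum gives an estimate for the p-th power that holds for every
    \<open>p > 0\<close>.\<close>
  have int_v: "integrable disk_area (\<lambda>z. \<bar>Im (f z)\<bar> powr p)"
  proof (rule Bochner_Integration.integrable_bound)
    show "integrable disk_area (\<lambda>z. 2 powr p * (\<bar>Im (f z) - Im (f 0)\<bar> powr p + \<bar>Im (f 0)\<bar> powr p))"
      by (intro integrable_mult_right Bochner_Integration.integrable_add int_d int_c) auto
    show "(\<lambda>z. \<bar>Im (f z)\<bar> powr p) \<in> borel_measurable disk_area"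
      using cv[of 0] by (intro borel_measurable_disk_area) simp
    show "AE z in disk_area. norm (\<bar>Im (f z)\<bar> powr p)
        \<le> norm (2 powr p * (\<bar>Im (f z) - Im (f 0)\<bar> powr p + \<bar>Im (f 0)\<bar> powr p))"
    proof (rule AE_I2)
      fix z
      define x y where "x = \<bar>Im (f z) - Im (f 0)\<bar>" and "y = \<bar>Im (f 0)\<bar>"
      have "\<bar>Im (f z)\<bar> \<le> x + y" unfolding x_def y_def by linarith
      also have "\<dots> \<le> 2 * max x y" by (simp add: max_def)
      finally have "\<bar>Im (f z)\<bar> powr p \<le> (2 * max x y) powr p"
        using p by (intro powr_mono2) auto
      also have "\<dots> = 2 powr p * (max x y) powr p" by (rule powr_mult)
      also have "\<dots> \<le> 2 powr p * (x powr p + y powr p)"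
        by (intro mult_left_mono) (auto simp: max_def)
      finally show "norm (\<bar>Im (f z)\<bar> powr p)
          \<le> norm (2 powr p * (\<bar>Im (f z) - Im (f 0)\<bar> powr p + \<bar>Im (f 0)\<bar> powr p))"
        by (simp add: x_def y_def)
    qed
  qed
  have "(\<lambda>z. Im (f z)) \<in> harmonic_bergman p"
    using v int_v by (simp add: harmonic_bergman_def)
  moreover have "bergman_norm p (\<lambda>z. Im (f z)) \<le> c powr (1 / p) * bergman_norm p (\<lambda>z. Re (f z))"
    if "Im (f 0) = 0"
  proof -
    let ?U = "LINT z|disk_area. \<bar>Re (f z)\<bar> powr p" and ?V = "LINT z|disk_area. \<bar>Im (f z)\<bar> powr p"
    have mv: "(\<lambda>z. ennreal (\<bar>Im (f z)\<bar> powr p)) \<in> borel_measurable disk_area"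
      and mu: "(\<lambda>z. ennreal (\<bar>Re (f z)\<bar> powr p)) \<in> borel_measurable disk_area"
      using int_v int_u by (auto intro!: measurable_compose[OF _ measurable_ennreal] borel_measurable_integrable)
    have "ennreal ?V = (\<integral>\<^sup>+z. ennreal (\<bar>Im (f z)\<bar> powr p) \<partial>disk_area)"
      using int_v by (intro nn_integral_eq_integral[symmetric]) auto
    also have "\<dots> \<le> ennreal c * (\<integral>\<^sup>+z. ennreal (\<bar>Re (f z)\<bar> powr p) \<partial>disk_area)"
      using mult_left_mono[OF bound, of "ennreal (1 / pi)"] that
      by (simp add: nn_integral_disk_area mu mv mult.left_commute)
    also have "\<dots> = ennreal (c * ?U)"
      using int_u c by (subst nn_integral_eq_integral) (auto simp: ennreal_mult)
    finally have "ennreal ?V \<le> ennreal (c * ?U)" .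
    moreover have "0 \<le> c * ?U" using c by (intro mult_nonneg_nonneg integral_nonneg_AE) auto
    ultimately have "?V \<le> c * ?U" by (simp add: ennreal_le_iff)
    then have "?V powr (1 / p) \<le> (c * ?U) powr (1 / p)"
      using p by (intro powr_mono2) (auto simp: integral_nonneg_AE)
    then show ?thesis by (simp add: bergman_norm_def powr_mult)
  qed
  ultimately show "(\<lambda>z. Im (f z)) \<in> harmonic_bergman p \<and> (Im (f 0) = 0 \<longrightarrow>
      bergman_norm p (\<lambda>z. Im (f z)) \<le> c powr (1 / p) * bergman_norm p (\<lambda>z. Re (f z)))"
    by blast
qed

end
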